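(* Let $d\ge2$ and let $q:\{1,\dots,d\}\times\{1,\dots,d\}\to\mathbb T$ satisfy $q(i,i)=1$ and $q(i,j)=\overline{q(j,i)}$. Every $q$-commutative $d$-tuple $(X_1,X_2,\dots,X_d)$ of isometric operators on a Hilbert space has a $q$-commutative unitary extension $(Y_1,Y_2,\dots,Y_d)$. Moreover, there is such an extension $(Y_1,Y_2,\dots,Y_d)$ for which $Y=Y_1Y_2\cdots Y_d$ is the minimal unitary extension of $X=X_1X_2\cdots X_d$.
   Context: A $d$-tuple $(V_1,\dots,V_d)$ of operators is $q$-commutative if $V_iV_j=q(i,j)V_jV_i$ for all $i,j$. $\mathbb T$ is the unit circle. A $q$-commutative unitary extension of $(X_1,\dots,X_d)$ on $\mathcal H$ is a $q$-commutative tuple $(Y_1,\dots,Y_d)$ of unitary operators on a Hilbert space $\mathcal K$ containing (an isometric copy of) $\mathcal H$ as a closed subspace, such that $\mathcal H$ is invariant under each $Y_i$ and $Y_i|_{\mathcal H}=X_i$. A unitary extension $Y$ on $\mathcal K\supseteq\mathcal H$ of an isometry $X$ on $\mathcal H$ is minimal if $\mathcal K=\overline{\operatorname{span}}\{Y^{n}h:h\in\mathcal H,\ n\in\mathbb Z\}$. *)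

theory Defs
  imports "HOL-Analysis.Analysis" "HOL-Algebra.Module"
begin

section \<open>Complex Hilbert spaces with explicit carriers\<close>

text \<open>
  The extension space is existentially quantified in the theorem, so Hilbert spaces have to be
  values rather than types. They are modules, in the sense of \<^theory>\<open>HOL-Algebra.Module\<close>, over
  the field of complex numbers, with an inner product. (The multiplication and unit that the module
  record inherits from the ring record are irrelevant, as for every module.)
\<close>

definition complex_ring :: "complex ring"
  where "complex_ring = \<lparr>carrier = UNIV, mult = (*), one = 1, zero = 0, add = (+)\<rparr>"

record 'a inner_module = "(complex, 'a) module" +
  inner_prod :: "'a \<Rightarrow> 'a \<Rightarrow> complex"

definition hnorm :: "'a inner_module \<Rightarrow> 'a \<Rightarrow> real"
  where "hnorm H x = sqrt (Re (inner_prod H x x))"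

text \<open>
  The locale \<^locale>\<open>Metric_space\<close> demands symmetry and nonnegativity of the distance on the
  whole type; hence the (otherwise irrelevant) value outside the carrier.
\<close>

definition hdist :: "'a inner_module \<Rightarrow> 'a \<Rightarrow> 'a \<Rightarrow> real"
  where "hdist H x y =
    (if x \<in> carrier H \<and> y \<in> carrier H then hnorm H (x \<ominus>\<^bsub>H\<^esub> y) else 0)"

definition htopology :: "'a inner_module \<Rightarrow> 'a topology"
  where "htopology H = Metric_space.mtopology (carrier H) (hdist H)"

locale inner_product_space = Module.module complex_ring H for H :: "'a inner_module" (structure) +
  assumes inner_add_left:
      "\<lbrakk>x \<in> carrier H; y \<in> carrier H; z \<in> carrier H\<rbrakk> \<Longrightarrow>
        inner_prod H (x \<oplus>\<^bsub>H\<^esub> y) z = inner_prod H x z + inner_prod H y z"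
    and inner_smult_left:
      "\<lbrakk>x \<in> carrier H; y \<in> carrier H\<rbrakk> \<Longrightarrow>
        inner_prod H (c \<odot>\<^bsub>H\<^esub> x) y = c * inner_prod H x y"
    and inner_commute:
      "\<lbrakk>x \<in> carrier H; y \<in> carrier H\<rbrakk> \<Longrightarrow> inner_prod H y x = cnj (inner_prod H x y)"
    and inner_self_nonneg:
      "x \<in> carrier H \<Longrightarrow> 0 \<le> Re (inner_prod H x x)"
    and inner_self_zero:
      "\<lbrakk>x \<in> carrier H; inner_prod H x x = 0\<rbrakk> \<Longrightarrow> x = \<zero>\<^bsub>H\<^esub>"

locale hilbert_space = inner_product_space +
  assumes complete: "Metric_space.mcomplete (carrier H) (hdist H)"

text \<open>
  The constants \<^term>\<open>Metric_space.mtopology\<close> and \<^term>\<open>Metric_space.mcomplete\<close> are only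
  meaningful for an actual metric, which \<^term>\<open>hdist H\<close> is.
\<close>

lemma complex_ring_simps [simp]:
  "carrier complex_ring = UNIV" "mult complex_ring = (*)" "one complex_ring = 1"
  "zero complex_ring = 0" "add complex_ring = (+)"
  by (simp_all add: complex_ring_def)

lemma complex_ring_cring: "cring complex_ring"
proof (rule cringI)
  show "abelian_group complex_ring"
    by (rule abelian_groupI) (auto intro: exI[of _ "- x" for x :: complex] simp: add_eq_0_iff2)
  show "comm_monoid complex_ring"
    by (rule comm_monoidI) auto
qed (auto simp: algebra_simps)

context inner_product_space
begin

lemma inner_add_right:
  assumes "x \<in> carrier H" "y \<in> carrier H" "z \<in> carrier H"
  shows "inner_prod H z (x \<oplus>\<^bsub>H\<^esub> y) = inner_prod H z x + inner_prod H z y"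
  using assms inner_commute[of _ z] inner_add_left[of x y z] by (metis M.a_closed complex_cnj_add)

lemma inner_smult_right:
  assumes "x \<in> carrier H" "y \<in> carrier H"
  shows "inner_prod H x (c \<odot>\<^bsub>H\<^esub> y) = cnj c * inner_prod H x y"
  using assms inner_commute[of "c \<odot>\<^bsub>H\<^esub> y" x] inner_commute[of y x] inner_smult_left[of y x c]
    smult_closed[of c y] by simp

lemma smult_minus_one:
  assumes "x \<in> carrier H"
  shows "(-1) \<odot>\<^bsub>H\<^esub> x = \<ominus>\<^bsub>H\<^esub> x"
proof -
  have "(-1) \<odot>\<^bsub>H\<^esub> x \<oplus>\<^bsub>H\<^esub> x = ((-1) + 1) \<odot>\<^bsub>H\<^esub> x"
    using assms smult_l_distr[of "-1" 1 x] smult_one[of x] by simp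
  also have "\<dots> = \<zero>\<^bsub>H\<^esub>"
    using assms smult_l_null[of x] by simp
  finally show ?thesis
    using assms smult_closed[of "-1" x] M.minus_equality by simp
qed

lemma inner_self_real:
  assumes "x \<in> carrier H"
  shows "inner_prod H x x = complex_of_real ((hnorm H x)\<^sup>2)"
  using assms inner_commute[of x x] inner_self_nonneg[of x]
  by (auto simp: hnorm_def complex_eq_iff)

lemma hnorm_nonneg: "x \<in> carrier H \<Longrightarrow> 0 \<le> hnorm H x"
  by (simp add: hnorm_def inner_self_nonneg)

lemma inner_zero_left: "y \<in> carrier H \<Longrightarrow> inner_prod H \<zero>\<^bsub>H\<^esub> y = 0"
  using inner_add_left[of "\<zero>\<^bsub>H\<^esub>" "\<zero>\<^bsub>H\<^esub>" y] by simp

lemma hnorm_eq_zero: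
  assumes "x \<in> carrier H"
  shows "hnorm H x = 0 \<longleftrightarrow> x = \<zero>\<^bsub>H\<^esub>"
  using assms inner_self_real[of x] inner_self_zero[of x] inner_zero_left[of x] by auto

lemma hnorm_smult:
  assumes "x \<in> carrier H"
  shows "hnorm H (c \<odot>\<^bsub>H\<^esub> x) = cmod c * hnorm H x"
proof -
  have "inner_prod H (c \<odot>\<^bsub>H\<^esub> x) (c \<odot>\<^bsub>H\<^esub> x) = (c * cnj c) * inner_prod H x x"
    using assms smult_closed[of c x] by (simp add: inner_smult_left inner_smult_right)
  also have "\<dots> = complex_of_real ((cmod c)\<^sup>2 * (hnorm H x)\<^sup>2)"
    using assms by (simp add: inner_self_real complex_norm_square[symmetric] del: of_real_power)
  finally have "Re (inner_prod H (c \<odot>\<^bsub>H\<^esub> x) (c \<odot>\<^bsub>H\<^esub> x)) = (cmod c * hnorm H x)\<^sup>2"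
    by (simp only: Re_complex_of_real power_mult_distrib)
  then have "hnorm H (c \<odot>\<^bsub>H\<^esub> x) = sqrt ((cmod c * hnorm H x)\<^sup>2)"
    by (simp add: hnorm_def)
  then show ?thesis
    using hnorm_nonneg[OF assms] by simp
qed

lemma hnorm_add_sq:
  assumes "x \<in> carrier H" "y \<in> carrier H"
  shows "(hnorm H (x \<oplus>\<^bsub>H\<^esub> y))\<^sup>2 = (hnorm H x)\<^sup>2 + 2 * Re (inner_prod H x y) + (hnorm H y)\<^sup>2"
proof -
  have "inner_prod H (x \<oplus>\<^bsub>H\<^esub> y) (x \<oplus>\<^bsub>H\<^esub> y) =
      inner_prod H x x + inner_prod H x y + (inner_prod H y x + inner_prod H y y)"
    using assms by (simp add: inner_add_left inner_add_right)
  then have "Re (inner_prod H (x \<oplus>\<^bsub>H\<^esub> y) (x \<oplus>\<^bsub>H\<^esub> y)) =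
      Re (inner_prod H x x) + 2 * Re (inner_prod H x y) + Re (inner_prod H y y)"
    using assms inner_commute[of x y] by simp
  then show ?thesis
    using inner_self_nonneg[OF assms(1)] inner_self_nonneg[OF assms(2)]
      inner_self_nonneg[OF M.a_closed[OF assms]] by (simp only: hnorm_def real_sqrt_pow2)
qed

lemma Re_inner_le:
  assumes x: "x \<in> carrier H" and y: "y \<in> carrier H"
  shows "Re (inner_prod H x y) \<le> hnorm H x * hnorm H y"
proof (cases "hnorm H x = 0 \<or> hnorm H y = 0")
  case True
  then have "inner_prod H x y = 0"
    using x y inner_zero_left[of x] inner_zero_left[of y] inner_commute[of y x]
    by (auto simp: hnorm_eq_zero)
  then show ?thesis using x y by (simp add: hnorm_nonneg)
next
  case False
  let ?a = "hnorm H x" and ?b = "hnorm H y"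
  have pos: "0 < ?a" "0 < ?b"
    using False hnorm_nonneg[OF x] hnorm_nonneg[OF y] by auto
  let ?u = "complex_of_real ?b \<odot>\<^bsub>H\<^esub> x" and ?v = "complex_of_real (- ?a) \<odot>\<^bsub>H\<^esub> y"
  have uv: "?u \<in> carrier H" "?v \<in> carrier H"
    using smult_closed x y by auto
  have "0 \<le> (hnorm H (?u \<oplus>\<^bsub>H\<^esub> ?v))\<^sup>2" by simp
  also have "\<dots> = (?b * ?a)\<^sup>2 + 2 * Re (inner_prod H ?u ?v) + (?a * ?b)\<^sup>2"
    using x y pos by (simp only: hnorm_add_sq[OF uv] hnorm_smult) simp
  also have "inner_prod H ?u ?v = complex_of_real (- (?a * ?b)) * inner_prod H x y"
    using uv x y by (simp add: inner_smult_left inner_smult_right)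
  also have "Re \<dots> = - (?a * ?b) * Re (inner_prod H x y)"
    by (simp only: Re_complex_of_real Im_complex_of_real times_complex.sel)
  finally have "?a * ?b * Re (inner_prod H x y) \<le> ?a * ?b * (?a * ?b)"
    by (simp add: power2_eq_square algebra_simps)
  then show ?thesis
    using pos by simp
qed

lemma hnorm_triangle:
  assumes x: "x \<in> carrier H" and y: "y \<in> carrier H"
  shows "hnorm H (x \<oplus>\<^bsub>H\<^esub> y) \<le> hnorm H x + hnorm H y"
proof (rule power2_le_imp_le)
  show "(hnorm H (x \<oplus>\<^bsub>H\<^esub> y))\<^sup>2 \<le> (hnorm H x + hnorm H y)\<^sup>2"
    using Re_inner_le[OF x y] by (simp add: hnorm_add_sq[OF x y] power2_sum)
qed (simp add: hnorm_nonneg x y)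

lemma Metric_space_hdist: "Metric_space (carrier H) (hdist H)"
proof
  fix x y z
  show "0 \<le> hdist H x y"
    by (simp add: hdist_def hnorm_nonneg)
  show "hdist H x y = hdist H y x"
  proof (cases "x \<in> carrier H \<and> y \<in> carrier H")
    case True
    then have "(-1) \<odot>\<^bsub>H\<^esub> (x \<ominus>\<^bsub>H\<^esub> y) = y \<ominus>\<^bsub>H\<^esub> x"
      by (simp add: smult_minus_one M.minus_add M.minus_minus M.a_comm a_minus_def)
    then show ?thesis
      using True hnorm_smult[of "x \<ominus>\<^bsub>H\<^esub> y" "-1"] by (simp add: hdist_def)
  qed (auto simp: hdist_def)
  assume x: "x \<in> carrier H" and y: "y \<in> carrier H"
  have "x \<ominus>\<^bsub>H\<^esub> y = \<zero>\<^bsub>H\<^esub> \<longleftrightarrow> x = y"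
    using x y M.minus_equality[of x "\<ominus>\<^bsub>H\<^esub> y"] M.r_neg by (auto simp: a_minus_def)
  then show "hdist H x y = 0 \<longleftrightarrow> x = y"
    using x y by (simp add: hdist_def hnorm_eq_zero)
  assume z: "z \<in> carrier H"
  have "x \<ominus>\<^bsub>H\<^esub> z = (x \<ominus>\<^bsub>H\<^esub> y) \<oplus>\<^bsub>H\<^esub> (y \<ominus>\<^bsub>H\<^esub> z)"
    using x y z by (simp add: a_minus_def M.a_assoc M.r_neg1)
  then show "hdist H x z \<le> hdist H x y + hdist H y z"
    using x y z hnorm_triangle[of "x \<ominus>\<^bsub>H\<^esub> y" "y \<ominus>\<^bsub>H\<^esub> z"] by (simp add: hdist_def)
qed

end

section \<open>Operators\<close>

text \<open>
  Operators are functions on the underlying type; their values outside the carrier are irrelevant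
  and never constrained.
\<close>

definition linear_map :: "'a inner_module \<Rightarrow> 'b inner_module \<Rightarrow> ('a \<Rightarrow> 'b) \<Rightarrow> bool"
  where "linear_map H K T \<longleftrightarrow>
    T \<in> carrier H \<rightarrow> carrier K \<and>
    (\<forall>x\<in>carrier H. \<forall>y\<in>carrier H. T (x \<oplus>\<^bsub>H\<^esub> y) = T x \<oplus>\<^bsub>K\<^esub> T y) \<and>
    (\<forall>c. \<forall>x\<in>carrier H. T (c \<odot>\<^bsub>H\<^esub> x) = c \<odot>\<^bsub>K\<^esub> T x)"

definition isometric_map :: "'a inner_module \<Rightarrow> 'b inner_module \<Rightarrow> ('a \<Rightarrow> 'b) \<Rightarrow> bool"
  where "isometric_map H K T \<longleftrightarrow>
    linear_map H K T \<and> (\<forall>x\<in>carrier H. hnorm K (T x) = hnorm H x)"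

definition unitary_op :: "'a inner_module \<Rightarrow> ('a \<Rightarrow> 'a) \<Rightarrow> bool"
  where "unitary_op H U \<longleftrightarrow>
    linear_map H H U \<and> bij_betw U (carrier H) (carrier H) \<and>
    (\<forall>x\<in>carrier H. \<forall>y\<in>carrier H. inner_prod H (U x) (U y) = inner_prod H x y)"

definition q_commutative ::
    "nat \<Rightarrow> (nat \<Rightarrow> nat \<Rightarrow> complex) \<Rightarrow> 'a inner_module \<Rightarrow> (nat \<Rightarrow> 'a \<Rightarrow> 'a) \<Rightarrow> bool"
  where "q_commutative d q H T \<longleftrightarrow>
    (\<forall>i\<in>{1..d}. \<forall>j\<in>{1..d}. \<forall>x\<in>carrier H. T i (T j x) = q i j \<odot>\<^bsub>H\<^esub> T j (T i x))"

text \<open>The product of operators \<open>T\<^sub>1 T\<^sub>2 \<dots> T\<^sub>d\<close> is composition, with \<open>T\<^sub>d\<close> applied first.\<close>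

definition op_product :: "nat \<Rightarrow> (nat \<Rightarrow> 'a \<Rightarrow> 'a) \<Rightarrow> 'a \<Rightarrow> 'a"
  where "op_product d T = foldr (\<circ>) (map T [1..<Suc d]) id"

definition op_power_int :: "'a inner_module \<Rightarrow> ('a \<Rightarrow> 'a) \<Rightarrow> int \<Rightarrow> 'a \<Rightarrow> 'a"
  where "op_power_int H U n =
    (if 0 \<le> n then U ^^ nat n else inv_into (carrier H) U ^^ nat (- n))"

section \<open>Unitary extensions\<close>

text \<open>\<open>K\<close> is a Hilbert space that contains \<open>H\<close>, via \<open>V\<close>, as a closed subspace.\<close>

definition hilbert_extension ::
    "'a inner_module \<Rightarrow> 'b inner_module \<Rightarrow> ('a \<Rightarrow> 'b) \<Rightarrow> bool"
  where "hilbert_extension H K V \<longleftrightarrow>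
    hilbert_space K \<and> isometric_map H K V \<and> closedin (htopology K) (V ` carrier H)"

text \<open>
  The intertwining relation says at once that the copy of \<open>H\<close> is invariant under \<open>Y\<close> and that the
  restriction of \<open>Y\<close> to it is \<open>X\<close>.
\<close>

definition unitary_extension ::
    "'a inner_module \<Rightarrow> ('a \<Rightarrow> 'a) \<Rightarrow> 'b inner_module \<Rightarrow> ('a \<Rightarrow> 'b) \<Rightarrow> ('b \<Rightarrow> 'b) \<Rightarrow> bool"
  where "unitary_extension H X K V Y \<longleftrightarrow>
    hilbert_extension H K V \<and> unitary_op K Y \<and> (\<forall>h\<in>carrier H. Y (V h) = V (X h))"

definition q_commutative_unitary_extension ::
    "nat \<Rightarrow> (nat \<Rightarrow> nat \<Rightarrow> complex) \<Rightarrow> 'a inner_module \<Rightarrow> (nat \<Rightarrow> 'a \<Rightarrow> 'a) \<Rightarrow>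
      'b inner_module \<Rightarrow> ('a \<Rightarrow> 'b) \<Rightarrow> (nat \<Rightarrow> 'b \<Rightarrow> 'b) \<Rightarrow> bool"
  where "q_commutative_unitary_extension d q H X K V Y \<longleftrightarrow>
    (\<forall>i\<in>{1..d}. unitary_extension H (X i) K V (Y i)) \<and> q_commutative d q K Y"

definition linear_span :: "'a inner_module \<Rightarrow> 'a set \<Rightarrow> 'a set"
  where "linear_span H S = \<Inter>{W. submodule W complex_ring H \<and> S \<subseteq> W}"

definition minimal_unitary_extension ::
    "'a inner_module \<Rightarrow> ('a \<Rightarrow> 'a) \<Rightarrow> 'b inner_module \<Rightarrow> ('a \<Rightarrow> 'b) \<Rightarrow> ('b \<Rightarrow> 'b) \<Rightarrow> bool"
  where "minimal_unitary_extension H X K V Y \<longleftrightarrow>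
    unitary_extension H X K V Y \<and>
    carrier K = htopology K closure_of
      linear_span K {op_power_int K Y n (V h) |n h. h \<in> carrier H}"

end

theory Submission
  imports Defs
begin

text \<open>
  Let \<open>Y\<close> on \<open>K\<close> be the minimal unitary extension of \<open>X = X\<^sub>1 \<dots> X\<^sub>d\<close>. As \<open>H\<close> is invariant under \<open>Y\<close>, the
  projections \<open>a\<^sub>n\<close> of \<open>Y\<^sup>n k\<close> onto \<open>H\<close> satisfy \<open>X\<^sup>* a\<^sub>n\<^sub>+\<^sub>1 = a\<^sub>n\<close>, and \<open>K\<close> is the space of all bounded
  sequences with this property, normed by \<open>lim \<parallel>a\<^sub>n\<parallel>\<close>; on it \<open>Y\<close> is the left shift. Since
  \<open>X X\<^sub>i = c\<^sub>i X\<^sub>i X\<close> with \<open>\<bar>c\<^sub>i\<bar> = 1\<close>, the contraction \<open>a \<mapsto> (cnj c\<^sub>i\<^sup>n X\<^sub>i\<^sup>* a\<^sub>n)\<^sub>n\<close> preserves \<open>K\<close>. Up to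
  unimodular scalars the product of these contractions, in any order, is the unitary \<open>Y\<^sup>*\<close>, so that
  each of them is unitary, and their inverses form the required tuple. Its product is exactly \<open>Y\<close>
  because \<open>c\<^sub>1 \<dots> c\<^sub>d = \<Prod>\<^sub>i\<^sub>,\<^sub>j q(j,i) = 1\<close>.
\<close>

section \<open>Adjoints of isometries\<close>

context inner_product_space
begin

lemma smult_1 [simp]: "x \<in> carrier H \<Longrightarrow> 1 \<odot> x = x"
  using smult_one[of x] by simp

lemma inner_diff_left:
  assumes "x \<in> carrier H" "y \<in> carrier H" "z \<in> carrier H"
  shows "inner_prod H (x \<ominus> y) z = inner_prod H x z - inner_prod H y z"
  using assms inner_add_left[of x "(-1) \<odot> y" z] inner_smult_left[of y z "-1"] smult_closed[of "-1" y]
  by (simp add: smult_minus_one a_minus_def)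

lemma inner_diff_right:
  assumes "x \<in> carrier H" "y \<in> carrier H" "z \<in> carrier H"
  shows "inner_prod H z (x \<ominus> y) = inner_prod H z x - inner_prod H z y"
  using assms inner_add_right[of x "(-1) \<odot> y" z] inner_smult_right[of z y "-1"] smult_closed[of "-1" y]
  by (simp add: smult_minus_one a_minus_def)

lemma minus_eq_zero_iff:
  assumes "x \<in> carrier H" "y \<in> carrier H"
  shows "x \<ominus> y = \<zero> \<longleftrightarrow> x = y"
  using assms Metric_space.zero[OF Metric_space_hdist, of x y]
  by (simp add: hdist_def hnorm_eq_zero)

lemma eq_if_inner_eq:
  assumes "x \<in> carrier H" "y \<in> carrier H"
    and "\<And>g. g \<in> carrier H \<Longrightarrow> inner_prod H x g = inner_prod H y g"
  shows "x = y"
proof -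
  have "inner_prod H (x \<ominus> y) (x \<ominus> y) = 0"
    using assms by (simp add: inner_diff_left)
  then show ?thesis
    using assms(1,2) inner_self_zero[of "x \<ominus> y"] minus_eq_zero_iff by simp
qed

lemma hnorm_sq: "x \<in> carrier H \<Longrightarrow> (hnorm H x)\<^sup>2 = Re (inner_prod H x x)"
  by (simp add: inner_self_real)

lemma hnorm_minus_commute:
  assumes "x \<in> carrier H" "y \<in> carrier H"
  shows "hnorm H (x \<ominus> y) = hnorm H (y \<ominus> x)"
  using assms Metric_space.commute[OF Metric_space_hdist, of x y] by (simp add: hdist_def)

lemma hnorm_diff_sq:
  assumes "x \<in> carrier H" "y \<in> carrier H"
  shows "(hnorm H (x \<ominus> y))\<^sup>2 = (hnorm H x)\<^sup>2 - 2 * Re (inner_prod H x y) + (hnorm H y)\<^sup>2"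
  using assms inner_commute[of x y]
  by (simp add: hnorm_sq inner_diff_left inner_diff_right)

lemma hnorm_triangle_minus:
  assumes "x \<in> carrier H" "y \<in> carrier H" "z \<in> carrier H"
  shows "hnorm H (x \<ominus> z) \<le> hnorm H (x \<ominus> y) + hnorm H (y \<ominus> z)"
  using assms Metric_space.triangle[OF Metric_space_hdist, of x y z] by (simp add: hdist_def)

lemma hnorm_zero [simp]: "hnorm H \<zero> = 0"
  by (simp add: hnorm_eq_zero)

lemma abs_hnorm_diff_le:
  assumes "x \<in> carrier H" "y \<in> carrier H"
  shows "\<bar>hnorm H x - hnorm H y\<bar> \<le> hnorm H (x \<ominus> y)"
proof -
  have "x \<ominus> \<zero> = x" "y \<ominus> \<zero> = y" using assms by (simp_all add: a_minus_def)
  then show ?thesis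
    using assms hnorm_triangle_minus[of x y "\<zero>"] hnorm_triangle_minus[of y x "\<zero>"]
      hnorm_minus_commute[of x y] by simp
qed

text \<open>Multiplying \<open>x\<close> by the conjugate of \<open>w = inner_prod H x y\<close>
  turns the inner product into the real number \<open>(cmod w)\<^sup>2\<close>, so that
  \<open>Re_inner_le\<close> applies; one factor \<open>cmod w\<close> is then cancelled.\<close>

lemma Cauchy_Schwarz:
  assumes "x \<in> carrier H" "y \<in> carrier H"
  shows "cmod (inner_prod H x y) \<le> hnorm H x * hnorm H y"
proof (cases "inner_prod H x y = 0")
  case False
  define w where "w = inner_prod H x y"
  have "Re (inner_prod H (cnj w \<odot> x) y) \<le> hnorm H (cnj w \<odot> x) * hnorm H y"
    using assms by (intro Re_inner_le) auto
  then have "(cmod w)\<^sup>2 \<le> cmod w * (hnorm H x * hnorm H y)"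
    using assms cmod_power2[of w]
    by (simp add: inner_smult_left hnorm_smult power2_eq_square mult.assoc flip: w_def)
  then show ?thesis
    using False by (simp add: w_def power2_eq_square)
qed (use assms hnorm_nonneg in simp)

text \<open>Polarisation: the norms of \<open>x\<close>, \<open>y\<close> and
  \<open>x \<oplus> y\<close> determine the real part of the inner product, and replacing
  \<open>x\<close> by \<open>\<i> \<odot> x\<close> gives the imaginary part.\<close>

lemma isometric_inner:
  assumes "isometric_map H H T" "x \<in> carrier H" "y \<in> carrier H"
  shows "inner_prod H (T x) (T y) = inner_prod H x y"
proof -
  have T: "T x \<in> carrier H" "hnorm H (T x) = hnorm H x" "T (c \<odot> x) = c \<odot> T x"
    "T (x \<oplus> y) = T x \<oplus> T y" if "x \<in> carrier H" "y \<in> carrier H" for x y c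
    using assms(1) that by (auto simp: isometric_map_def linear_map_def)
  have re: "Re (inner_prod H (T x) (T y)) = Re (inner_prod H x y)"
    if "x \<in> carrier H" "y \<in> carrier H" for x y
    using hnorm_add_sq[OF that] hnorm_add_sq[of "T x" "T y"] T[OF that] T[OF that(2,1)]
      T[of "x \<oplus> y" x] that by simp
  show ?thesis
    using re[of x y] re[of "\<i> \<odot> x" y] assms(2,3) T[of x y] T[of y y]
    by (auto simp: inner_smult_left complex_eq_iff)
qed

end

section \<open>Completeness and the Riesz representation theorem\<close>

context hilbert_space
begin

lemma Cauchy_has_limit:
  assumes s: "\<And>n. s n \<in> carrier H"
    and C: "\<And>e. 0 < e \<Longrightarrow> \<exists>N. \<forall>m\<ge>N. \<forall>n\<ge>N. hnorm H (s m \<ominus> s n) < e"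
  obtains l where "l \<in> carrier H" "(\<lambda>n. hnorm H (s n \<ominus> l)) \<longlonglongrightarrow> 0"
proof -
  interpret Metric_space "carrier H" "hdist H" by (rule Metric_space_hdist)
  have "MCauchy s"
    unfolding MCauchy_def using s C by (auto simp: hdist_def)
  then obtain l where l: "limitin mtopology s l sequentially"
    using complete by (auto simp: mcomplete_def)
  then have "l \<in> carrier H" "\<forall>e>0. \<forall>\<^sub>F n in sequentially. hnorm H (s n \<ominus> l) < e"
    using s by (auto simp: limitin_metric hdist_def)
  then show ?thesis
    using that[of l] s by (auto simp: tendsto_iff hnorm_nonneg)
qed

text \<open>The representing vector minimises \<open>\<parallel>h\<parallel>\<^sup>2 - 2 Re (\<phi> h)\<close>.\<close>

lemma Riesz_representation:
  assumes add: "\<And>g h. g \<in> carrier H \<Longrightarrow> h \<in> carrier H \<Longrightarrow> \<phi> (g \<oplus> h) = \<phi> g + \<phi> h"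
    and smult: "\<And>c g. g \<in> carrier H \<Longrightarrow> \<phi> (c \<odot> g) = cnj c * \<phi> g"
    and bound: "\<And>g. g \<in> carrier H \<Longrightarrow> cmod (\<phi> g) \<le> M * hnorm H g"
  obtains z where "z \<in> carrier H" "\<And>g. g \<in> carrier H \<Longrightarrow> \<phi> g = inner_prod H z g"
proof -
  define f where "f h = (hnorm H h)\<^sup>2 - 2 * Re (\<phi> h)" for h
  \<comment> \<open>Completing the square shows that \<open>f\<close> is bounded below, so that its
    infimum \<open>\<delta>\<close> can be used.\<close>
  have low: "- M\<^sup>2 \<le> f h" if "h \<in> carrier H" for h
  proof -
    have "0 \<le> (hnorm H h - M)\<^sup>2" by simp
    moreover have "Re (\<phi> h) \<le> M * hnorm H h"
      using bound[OF that] complex_Re_le_cmod[of "\<phi> h"] by linarith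
    ultimately show ?thesis
      by (simp add: f_def power2_diff algebra_simps)
  qed
  define \<delta> where "\<delta> = (INF h\<in>carrier H. f h)"
  have bdd: "bdd_below (f ` carrier H)" using low by (auto simp: bdd_below_def)
  have \<delta>: "\<delta> \<le> f h" if "h \<in> carrier H" for h
    unfolding \<delta>_def using bdd that by (rule cINF_lower)
  \<comment> \<open>Parallelogram law: the midpoint of \<open>g\<close> and \<open>h\<close> has
    value at least \<open>\<delta>\<close>, so two near-minimisers are close to each other. Hence
    every minimising sequence is Cauchy.\<close>
  have par: "(hnorm H (g \<ominus> h))\<^sup>2 \<le> 2 * (f g - \<delta>) + 2 * (f h - \<delta>)"
    if "g \<in> carrier H" "h \<in> carrier H" for g h
  proof -
    have "f ((1/2) \<odot> (g \<oplus> h)) = (hnorm H (g \<oplus> h))\<^sup>2 / 4 - Re (\<phi> g) - Re (\<phi> h)"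
      using that by (simp add: f_def smult add hnorm_smult power_divide add_divide_distrib)
    then have "4 * \<delta> \<le> (hnorm H (g \<oplus> h))\<^sup>2 - 4 * Re (\<phi> g) - 4 * Re (\<phi> h)"
      using \<delta>[of "(1/2) \<odot> (g \<oplus> h)"] that by simp
    then show ?thesis
      using that by (simp add: f_def hnorm_diff_sq hnorm_add_sq)
  qed
  have "\<exists>h. h \<in> carrier H \<and> f h < \<delta> + 1 / real (Suc n)" for n
  proof -
    have "(INF h\<in>carrier H. f h) < \<delta> + 1 / real (Suc n)"
      unfolding \<delta>_def[symmetric] by simp
    moreover have "carrier H \<noteq> {}" using M.zero_closed by blast
    ultimately show ?thesis
      using bdd by (auto simp: cINF_less_iff)
  qed
  then obtain s where s: "s n \<in> carrier H" "f (s n) < \<delta> + 1 / real (Suc n)" for n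
    by metis
  have "\<exists>N. \<forall>m\<ge>N. \<forall>n\<ge>N. hnorm H (s m \<ominus> s n) < e" if "0 < e" for e
  proof -
    from that have "0 < e\<^sup>2 / 4" by simp
    then obtain N where N: "1 / real (Suc N) < e\<^sup>2 / 4" by (rule nat_approx_posE)
    have small: "f (s m) - \<delta> < e\<^sup>2 / 4" if "N \<le> m" for m
    proof -
      have "1 / real (Suc m) \<le> 1 / real (Suc N)" using that by (simp add: field_simps)
      then show ?thesis using s(2)[of m] N by linarith
    qed
    show ?thesis
    proof (intro exI allI impI)
      fix m n assume mn: "N \<le> m" "N \<le> n"
      have "(hnorm H (s m \<ominus> s n))\<^sup>2 \<le> 2 * (f (s m) - \<delta>) + 2 * (f (s n) - \<delta>)"
        by (rule par) (rule s)+
      also have "\<dots> < 2 * (e\<^sup>2 / 4) + 2 * (e\<^sup>2 / 4)"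
        using small[OF mn(1)] small[OF mn(2)] by (intro add_strict_mono mult_strict_left_mono) auto
      finally have "(hnorm H (s m \<ominus> s n))\<^sup>2 < e\<^sup>2" by simp
      then show "hnorm H (s m \<ominus> s n) < e"
        using that by (simp add: power_less_imp_less_base)
    qed
  qed
  then obtain z where z: "z \<in> carrier H" "(\<lambda>n. hnorm H (s n \<ominus> z)) \<longlonglongrightarrow> 0"
    using s(1) Cauchy_has_limit by metis
  have "(\<lambda>n. hnorm H (s n) - hnorm H z) \<longlonglongrightarrow> 0"
    by (rule tendsto_0_le[OF z(2), of _ 1]) (use abs_hnorm_diff_le s z hnorm_nonneg in auto)
  then have 1: "(\<lambda>n. hnorm H (s n)) \<longlonglongrightarrow> hnorm H z" by (simp add: LIM_zero_iff)
  have diff: "\<phi> (s n) - \<phi> z = \<phi> (s n \<ominus> z)" for n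
    using s(1)[of n] z(1) add[of "s n" "(-1) \<odot> z"] smult[of z "-1"]
      smult_closed[of "-1" z] by (simp add: a_minus_def smult_minus_one)
  have "(\<lambda>n. \<phi> (s n) - \<phi> z) \<longlonglongrightarrow> 0"
    by (rule tendsto_0_le[OF z(2), of _ M])
      (use bound s z hnorm_nonneg in \<open>auto simp: diff mult.commute\<close>)
  then have 2: "(\<lambda>n. \<phi> (s n)) \<longlonglongrightarrow> \<phi> z" by (simp add: LIM_zero_iff)
  have "(\<lambda>n. f (s n)) \<longlonglongrightarrow> f z"
    unfolding f_def by (intro tendsto_intros 1 2)
  moreover have "(\<lambda>n. \<delta> + 1 / real (Suc n)) \<longlonglongrightarrow> \<delta>"
    using tendsto_add[OF tendsto_const LIMSEQ_Suc[OF lim_1_over_n], of \<delta>] by simp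
  ultimately have fz: "f z \<le> \<delta>"
    by (rule LIMSEQ_le) (use s less_imp_le in blast)
  have "\<phi> g = inner_prod H z g" if g: "g \<in> carrier H" for g
  proof -
    define w where "w = inner_prod H z g - \<phi> g"
    \<comment> \<open>The minimiser \<open>z\<close> is moved along \<open>g\<close> against the
      discrepancy \<open>w\<close>. With this \<open>r\<close> the quadratic term is at most half of
      the linear gain \<open>2 * (r * (cmod w)\<^sup>2)\<close>, so minimality forces
      \<open>w = 0\<close>.\<close>
    define r where "r = 1 / ((hnorm H g)\<^sup>2 + 1)"
    define t where "t = - (complex_of_real r * w)"
    have r: "0 < r" "r * (hnorm H g)\<^sup>2 \<le> 1"
      by (auto simp: r_def field_simps add_pos_nonneg add_nonneg_pos)
    have "f (z \<oplus> t \<odot> g) = f z + 2 * Re (cnj t * w) + (cmod t)\<^sup>2 * (hnorm H g)\<^sup>2"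
      using z g by (simp add: f_def w_def hnorm_add_sq add smult inner_smult_right hnorm_smult
          power_mult_distrib algebra_simps)
    also have "Re (cnj t * w) = - r * (Re w * Re w + Im w * Im w)"
      by (simp add: t_def algebra_simps)
    also have "Re w * Re w + Im w * Im w = (cmod w)\<^sup>2"
      by (simp add: cmod_power2 flip: power2_eq_square)
    also have "(cmod t)\<^sup>2 = r * (r * (cmod w)\<^sup>2)"
      using r by (simp add: t_def norm_mult power_mult_distrib power2_eq_square)
    finally have "f z + 2 * (r * (cmod w)\<^sup>2) \<le> f z + (r * (cmod w)\<^sup>2) * (r * (hnorm H g)\<^sup>2)"
      using \<delta>[of "z \<oplus> t \<odot> g"] fz z g by (simp add: algebra_simps)
    also have "(r * (cmod w)\<^sup>2) * (r * (hnorm H g)\<^sup>2) \<le> (r * (cmod w)\<^sup>2) * 1"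
      using r by (intro mult_left_mono) auto
    finally have "r * (cmod w)\<^sup>2 \<le> 0" by simp
    then have "w = 0" using r by (simp add: mult_le_0_iff)
    then show ?thesis by (simp add: w_def)
  qed
  then show ?thesis using that z by blast
qed

end

section \<open>Isometric and unitary operators\<close>

lemma isometric_map_closed:
  assumes "isometric_map H H T" "x \<in> carrier H"
  shows "T x \<in> carrier H"
  using assms by (auto simp: isometric_map_def linear_map_def)

lemma isometric_map_comp:
  assumes "isometric_map H H S" "isometric_map H H T"
  shows "isometric_map H H (S \<circ> T)"
  using assms by (auto simp: isometric_map_def linear_map_def Pi_iff)

lemma isometric_map_id: "isometric_map H H id"
  by (auto simp: isometric_map_def linear_map_def)

context inner_product_space
begin

lemma isometric_map_inj:
  assumes "isometric_map H H T" "x \<in> carrier H" "y \<in> carrier H" "T x = T y"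
  shows "x = y"
proof (rule eq_if_inner_eq)
  fix g assume "g \<in> carrier H"
  then show "inner_prod H x g = inner_prod H y g"
    using assms isometric_inner[of T x g] isometric_inner[of T y g] by simp
qed (use assms in auto)

lemma unitary_opI:
  assumes "isometric_map H H T" "bij_betw T (carrier H) (carrier H)"
  shows "unitary_op H T"
  using assms isometric_inner by (simp add: unitary_op_def isometric_map_def)

lemma unitary_op_cong:
  assumes "unitary_op H T" "\<And>x. x \<in> carrier H \<Longrightarrow> U x = T x"
  shows "unitary_op H U"
proof -
  have "bij_betw U (carrier H) (carrier H) = bij_betw T (carrier H) (carrier H)"
    by (rule bij_betw_cong) (rule assms(2))
  then show ?thesis
    using assms by (auto simp: unitary_op_def linear_map_def Pi_iff)
qed

lemma unitary_op_inv_into: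
  assumes T: "unitary_op H T"
  shows "unitary_op H (inv_into (carrier H) T)"
proof -
  let ?I = "inv_into (carrier H) T"
  have bij: "bij_betw T (carrier H) (carrier H)" and lin: "linear_map H H T"
    and inn: "\<And>x y. \<lbrakk>x \<in> carrier H; y \<in> carrier H\<rbrakk> \<Longrightarrow> inner_prod H (T x) (T y) = inner_prod H x y"
    using T by (auto simp: unitary_op_def)
  have cl: "?I x \<in> carrier H" and TI: "T (?I x) = x" if "x \<in> carrier H" for x
    using bij that by (auto simp: bij_betw_def inv_into_into f_inv_into_f)
  have eq: "?I y = x" if "T x = y" "x \<in> carrier H" for x y
    using bij that by (auto simp: bij_betw_def)
  show ?thesis
    unfolding unitary_op_def linear_map_def
  proof (intro conjI ballI allI)
    fix x y assume "x \<in> carrier H" "y \<in> carrier H"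
    then show "?I (x \<oplus> y) = ?I x \<oplus> ?I y"
      using lin by (intro eq) (auto simp: linear_map_def cl TI)
  next
    fix c x assume "x \<in> carrier H"
    then show "?I (c \<odot> x) = c \<odot> ?I x"
      using lin by (intro eq) (auto simp: linear_map_def cl TI)
  next
    fix x y assume "x \<in> carrier H" "y \<in> carrier H"
    then show "inner_prod H (?I x) (?I y) = inner_prod H x y"
      using inn[of "?I x" "?I y"] by (simp add: cl TI)
  qed (use cl bij bij_betw_inv_into in auto)
qed

text \<open>The description only refers to values of \<open>T\<close> on the carrier, so operators
  that agree there have the same adjoint. Existence is a separate matter, settled below for
  isometries by the Riesz theorem.\<close>

definition adjoint :: "('a \<Rightarrow> 'a) \<Rightarrow> 'a \<Rightarrow> 'a"
  where "adjoint T y =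
    (THE z. z \<in> carrier H \<and> (\<forall>g\<in>carrier H. inner_prod H y (T g) = inner_prod H z g))"

lemma adjoint_eqI:
  assumes "z \<in> carrier H" "\<And>g. g \<in> carrier H \<Longrightarrow> inner_prod H y (T g) = inner_prod H z g"
  shows "adjoint T y = z"
  unfolding adjoint_def
  by (rule the_equality) (use assms in \<open>auto intro!: eq_if_inner_eq\<close>)

end

section \<open>Existence and calculus of adjoints\<close>

context hilbert_space
begin

lemma adjoint_exists:
  assumes T: "isometric_map H H T" and y: "y \<in> carrier H"
  shows "adjoint T y \<in> carrier H \<and> (\<forall>g\<in>carrier H. inner_prod H y (T g) = inner_prod H (adjoint T y) g)"
proof -
  have TD: "T g \<in> carrier H" "hnorm H (T g) = hnorm H g" "T (c \<odot> g) = c \<odot> T g"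
    "h \<in> carrier H \<Longrightarrow> T (g \<oplus> h) = T g \<oplus> T h" if "g \<in> carrier H" for c g h
    using that T by (auto simp: isometric_map_def linear_map_def)
  obtain z where "z \<in> carrier H" "\<And>g. g \<in> carrier H \<Longrightarrow> inner_prod H y (T g) = inner_prod H z g"
  proof (rule Riesz_representation[of "\<lambda>g. inner_prod H y (T g)" "hnorm H y"])
    fix g assume "g \<in> carrier H"
    then show "cmod (inner_prod H y (T g)) \<le> hnorm H y * hnorm H g"
      using Cauchy_Schwarz[of y "T g"] y by (simp add: TD)
  qed (use y in \<open>auto simp: TD inner_add_right inner_smult_right\<close>)
  then show ?thesis
    using adjoint_eqI[of z y T] by simp
qed

lemma adjoint_closed [simp]:
  "isometric_map H H T \<Longrightarrow> y \<in> carrier H \<Longrightarrow> adjoint T y \<in> carrier H"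
  using adjoint_exists by blast

lemma inner_adjoint:
  "isometric_map H H T \<Longrightarrow> y \<in> carrier H \<Longrightarrow> g \<in> carrier H \<Longrightarrow>
    inner_prod H (adjoint T y) g = inner_prod H y (T g)"
  using adjoint_exists by simp

lemma adjoint_isometry:
  "isometric_map H H T \<Longrightarrow> x \<in> carrier H \<Longrightarrow> adjoint T (T x) = x"
  by (rule adjoint_eqI) (auto simp: isometric_inner)

lemma adjoint_add:
  assumes "isometric_map H H T" "x \<in> carrier H" "y \<in> carrier H"
  shows "adjoint T (x \<oplus> y) = adjoint T x \<oplus> adjoint T y"
  using assms by (intro adjoint_eqI) (auto simp: inner_add_left inner_adjoint isometric_map_closed)

lemma adjoint_smult:
  assumes "isometric_map H H T" "x \<in> carrier H"
  shows "adjoint T (c \<odot> x) = c \<odot> adjoint T x"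
  using assms by (intro adjoint_eqI) (auto simp: inner_smult_left inner_adjoint isometric_map_closed)

text \<open>Adjoints reverse products and conjugate scalars. \<open>U\<close> is given only by its
  values on the carrier, which lets a commutation relation be substituted directly.\<close>

lemma adjoint_comp:
  assumes "isometric_map H H S" "isometric_map H H T" "y \<in> carrier H"
    and "\<And>g. g \<in> carrier H \<Longrightarrow> U g = c \<odot> S (T g)"
  shows "adjoint U y = cnj c \<odot> adjoint T (adjoint S y)"
  using assms
  by (intro adjoint_eqI) (auto simp: inner_smult_left inner_smult_right inner_adjoint isometric_map_closed)

lemma adjoint_comp':
  assumes "isometric_map H H S" "isometric_map H H T" "y \<in> carrier H"
    and "\<And>g. g \<in> carrier H \<Longrightarrow> U g = S (T g)"
  shows "adjoint U y = adjoint T (adjoint S y)"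
  using assms
  by (intro adjoint_eqI) (auto simp: inner_adjoint isometric_map_closed)

text \<open>Pairing \<open>z = adjoint T y\<close> with itself gives
  \<open>(hnorm H z)\<^sup>2 = Re (inner_prod H y (T z))\<close>, which is at most
  \<open>hnorm H y * hnorm H z\<close> because \<open>T\<close> preserves the norm of
  \<open>z\<close>.\<close>

lemma hnorm_adjoint_le:
  assumes "isometric_map H H T" "y \<in> carrier H"
  shows "hnorm H (adjoint T y) \<le> hnorm H y"
proof -
  let ?z = "adjoint T y"
  have z: "?z \<in> carrier H" "T ?z \<in> carrier H" "hnorm H (T ?z) = hnorm H ?z"
    using assms by (auto simp: isometric_map_closed) (auto simp: isometric_map_def)
  have "(hnorm H ?z)\<^sup>2 = Re (inner_prod H y (T ?z))"
    using assms z by (simp add: hnorm_sq inner_adjoint)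
  also have "\<dots> \<le> hnorm H y * hnorm H ?z"
    using Re_inner_le[of y "T ?z"] assms z by simp
  finally show ?thesis
    using hnorm_nonneg[OF z(1)] hnorm_nonneg[OF assms(2)]
    by (cases "hnorm H ?z = 0") (auto simp: power2_eq_square)
qed

end

section \<open>The minimal unitary extension of an isometry\<close>

locale isometry = hilbert_space +
  fixes X
  assumes X: "isometric_map H H X"
begin

text \<open>
  A vector \<open>k\<close> of the minimal unitary extension space is encoded by the sequence of the
  projections onto \<open>H\<close> of \<open>Y\<^sup>n k\<close>.
\<close>

definition K :: "(nat \<Rightarrow> 'a) inner_module"
  where "K = \<lparr>carrier = {a. (\<forall>n. a n \<in> carrier H \<and> adjoint X (a (Suc n)) = a n) \<and>
                (\<exists>M. \<forall>n. hnorm H (a n) \<le> M)},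
      mult = undefined, one = undefined, zero = (\<lambda>n. \<zero>), add = (\<lambda>a b n. a n \<oplus> b n),
      smult = (\<lambda>c a n. c \<odot> a n),
      inner_prod = (\<lambda>a b. lim (\<lambda>n. inner_prod H (a n) (b n)))\<rparr>"

section \<open>The sequence space as a Hilbert space\<close>

lemma K_sel:
  "zero K = (\<lambda>n. \<zero>)" "a \<oplus>\<^bsub>K\<^esub> b = (\<lambda>n. a n \<oplus> b n)" "c \<odot>\<^bsub>K\<^esub> a = (\<lambda>n. c \<odot> a n)"
  by (simp_all add: K_def)

lemma K_I:
  assumes "\<And>n. a n \<in> carrier H" "\<And>n. adjoint X (a (Suc n)) = a n" "\<And>n. hnorm H (a n) \<le> M"
  shows "a \<in> carrier K"
  using assms by (auto simp: K_def)

lemma K_closed [simp]: "a \<in> carrier K \<Longrightarrow> a n \<in> carrier H"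
  and K_adjoint [simp]: "a \<in> carrier K \<Longrightarrow> adjoint X (a (Suc n)) = a n"
  and K_bounded: "a \<in> carrier K \<Longrightarrow> \<exists>M. \<forall>n. hnorm H (a n) \<le> M"
  by (simp_all add: K_def)

lemma K_add:
  assumes "a \<in> carrier K" "b \<in> carrier K"
  shows "(\<lambda>n. a n \<oplus> b n) \<in> carrier K"
proof -
  obtain M N where MN: "hnorm H (a n) \<le> M" "hnorm H (b n) \<le> N" for n
    using assms[THEN K_bounded] by blast
  have "hnorm H (a n \<oplus> b n) \<le> M + N" for n
    using assms hnorm_triangle[of "a n" "b n"] MN[of n] by simp
  then show ?thesis
    using assms X by (intro K_I[of _ "M + N"]) (auto simp: adjoint_add)
qed

lemma K_smult:
  assumes "a \<in> carrier K"
  shows "(\<lambda>n. c \<odot> a n) \<in> carrier K"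
proof -
  obtain M where M: "hnorm H (a n) \<le> M" for n
    using assms[THEN K_bounded] by blast
  then have "hnorm H (c \<odot> a n) \<le> cmod c * M" for n
    using assms by (simp add: hnorm_smult mult_left_mono)
  then show ?thesis
    using assms X by (intro K_I[of _ "cmod c * M"]) (auto simp: adjoint_smult)
qed

lemma K_zero: "(\<lambda>n. \<zero>) \<in> carrier K"
proof (rule K_I[of _ 0])
  show "adjoint X \<zero> = \<zero>" for n
    using X by (intro adjoint_eqI) (auto simp: inner_zero_left isometric_map_closed)
qed auto

text \<open>Each coordinate is the image of the next one under the adjoint of \<open>X\<close>, a
  contraction.\<close>

lemma K_incseq:
  assumes "a \<in> carrier K"
  shows "incseq (\<lambda>n. hnorm H (a n))"
  using hnorm_adjoint_le[OF X K_closed[OF assms, of "Suc n" for n]] assms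
  by (intro incseq_SucI) simp

text \<open>Justifies the \<open>lim\<close> in the inner product of \<open>K\<close>. Norms
  converge because they increase and are bounded; polarisation transfers this to real parts of inner
  products, and the factor \<open>- \<i>\<close> turns imaginary parts into real ones.\<close>

lemma K_inner_tendsto:
  assumes a: "a \<in> carrier K" and b: "b \<in> carrier K"
  shows "(\<lambda>n. inner_prod H (a n) (b n)) \<longlonglongrightarrow> inner_prod K a b"
proof -
  have nc: "convergent (\<lambda>n. hnorm H (a n))" if a: "a \<in> carrier K" for a
  proof -
    obtain M where "\<forall>n. hnorm H (a n) \<le> M" using K_bounded[OF a] by blast
    then obtain L where "(\<lambda>n. hnorm H (a n)) \<longlonglongrightarrow> L"
      by (rule incseq_convergent[OF K_incseq[OF a]])
    then show ?thesis by (rule convergentI)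
  qed
  have re: "convergent (\<lambda>n. Re (inner_prod H (a n) (b n)))"
    if a: "a \<in> carrier K" and b: "b \<in> carrier K" for a b
  proof -
    obtain l1 l2 l3 where l: "(\<lambda>n. hnorm H (a n \<oplus> b n)) \<longlonglongrightarrow> l1" "(\<lambda>n. hnorm H (a n)) \<longlonglongrightarrow> l2"
      "(\<lambda>n. hnorm H (b n)) \<longlonglongrightarrow> l3"
      using nc[OF K_add[OF a b]] nc[OF a] nc[OF b] by (auto simp: convergent_def)
    have "(\<lambda>n. ((hnorm H (a n \<oplus> b n))\<^sup>2 - (hnorm H (a n))\<^sup>2 - (hnorm H (b n))\<^sup>2) / 2)
        \<longlonglongrightarrow> (l1\<^sup>2 - l2\<^sup>2 - l3\<^sup>2) / 2"
      by (intro tendsto_intros l) simp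
    then show ?thesis
      using a b by (auto simp: convergent_def hnorm_add_sq)
  qed
  obtain u v where u: "(\<lambda>n. Re (inner_prod H (a n) (b n))) \<longlonglongrightarrow> u"
    and v: "(\<lambda>n. Re (inner_prod H (- \<i> \<odot> a n) (b n))) \<longlonglongrightarrow> v"
    using re[OF a b] re[OF K_smult[OF a] b] by (force simp: convergent_def)
  have "(\<lambda>n. Im (inner_prod H (a n) (b n))) \<longlonglongrightarrow> v"
    using v a b by (simp add: inner_smult_left)
  with u have "(\<lambda>n. inner_prod H (a n) (b n)) \<longlonglongrightarrow> Complex u v"
    by (simp add: tendsto_complex_iff)
  then have "convergent (\<lambda>n. inner_prod H (a n) (b n))"
    by (auto simp: convergent_def)
  then have "(\<lambda>n. inner_prod H (a n) (b n)) \<longlonglongrightarrow> lim (\<lambda>n. inner_prod H (a n) (b n))"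
    by (rule convergent_LIMSEQ_iff[THEN iffD1])
  moreover have "inner_prod K a b = lim (\<lambda>n. inner_prod H (a n) (b n))"
    by (simp only: K_def inner_module.select_convs)
  ultimately show ?thesis by (simp only:)
qed

lemma K_inner_eqI:
  assumes "a \<in> carrier K" "b \<in> carrier K" "(\<lambda>n. inner_prod H (a n) (b n)) \<longlonglongrightarrow> l"
  shows "inner_prod K a b = l"
  using LIMSEQ_unique[OF K_inner_tendsto[OF assms(1,2)] assms(3)] .

lemma K_hnorm_tendsto:
  assumes "a \<in> carrier K"
  shows "(\<lambda>n. hnorm H (a n)) \<longlonglongrightarrow> hnorm K a"
  unfolding hnorm_def using assms by (intro tendsto_intros K_inner_tendsto)

text \<open>The norm of \<open>K\<close> is an increasing limit of coordinate norms, so each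
  coordinate map is a contraction from \<open>K\<close> to \<open>H\<close>.\<close>

lemma K_hnorm_ge:
  assumes "a \<in> carrier K"
  shows "hnorm H (a n) \<le> hnorm K a"
  using incseq_le[OF K_incseq K_hnorm_tendsto] assms by simp

lemma K_module: "Module.module complex_ring K"
proof (rule module.intro)
  show "cring complex_ring" by (rule complex_ring_cring)
  show "abelian_group K"
  proof (rule abelian_groupI)
    fix a assume a: "a \<in> carrier K"
    have "(-1) \<odot> a n \<oplus> a n = \<zero>" for n
      using a by (simp add: smult_minus_one M.l_neg)
    then show "\<exists>b\<in>carrier K. b \<oplus>\<^bsub>K\<^esub> a = \<zero>\<^bsub>K\<^esub>"
      using K_smult[OF a, of "-1"] by (intro bexI[of _ "\<lambda>n. (-1) \<odot> a n"]) (auto simp: K_sel)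
  qed (auto simp: K_sel K_add K_zero M.a_ac)
  show "module_axioms complex_ring K"
    using smult_l_distr smult_r_distr smult_assoc1 smult_one
    by (unfold_locales) (auto simp: K_sel K_smult)
qed

lemma K_inner_product_space: "inner_product_space K"
proof (rule inner_product_space.intro[OF K_module], unfold_locales)
  fix a b c assume a: "a \<in> carrier K" and b: "b \<in> carrier K" and c: "c \<in> carrier K"
  have "(\<lambda>n. inner_prod H (a n \<oplus> b n) (c n)) \<longlonglongrightarrow> inner_prod K a c + inner_prod K b c"
    using tendsto_add[OF K_inner_tendsto K_inner_tendsto] a b c by (simp add: inner_add_left)
  then show "inner_prod K (a \<oplus>\<^bsub>K\<^esub> b) c = inner_prod K a c + inner_prod K b c"
    using a b c by (intro K_inner_eqI) (auto simp: K_sel K_add)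
next
  fix a b c assume a: "a \<in> carrier K" and b: "b \<in> carrier K"
  have "(\<lambda>n. inner_prod H (c \<odot> a n) (b n)) \<longlonglongrightarrow> c * inner_prod K a b"
    using tendsto_mult_left[OF K_inner_tendsto] a b by (simp add: inner_smult_left)
  then show "inner_prod K (c \<odot>\<^bsub>K\<^esub> a) b = c * inner_prod K a b"
    using a b by (intro K_inner_eqI) (auto simp: K_sel K_smult)
next
  fix a b assume a: "a \<in> carrier K" and b: "b \<in> carrier K"
  have "(\<lambda>n. inner_prod H (b n) (a n)) \<longlonglongrightarrow> cnj (inner_prod K a b)"
    using tendsto_cnj[OF K_inner_tendsto[OF a b]] a b by (simp add: inner_commute[symmetric])
  then show "inner_prod K b a = cnj (inner_prod K a b)"
    using a b by (intro K_inner_eqI)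
next
  fix a assume a: "a \<in> carrier K"
  show "0 \<le> Re (inner_prod K a a)"
    by (rule LIMSEQ_le_const[OF tendsto_Re[OF K_inner_tendsto[OF a a]]])
      (use a inner_self_nonneg in auto)
  assume "inner_prod K a a = 0"
  then have "hnorm K a = 0" by (simp add: hnorm_def)
  then have "hnorm H (a n) = 0" for n
    using K_hnorm_ge[OF a, of n] hnorm_nonneg[of "a n"] a by simp
  then show "a = \<zero>\<^bsub>K\<^esub>"
    using a by (auto simp: hnorm_eq_zero K_sel)
qed

interpretation K: inner_product_space K
  by (rule K_inner_product_space)

lemma K_diff:
  assumes "a \<in> carrier K" "b \<in> carrier K"
  shows "a \<ominus>\<^bsub>K\<^esub> b = (\<lambda>n. a n \<ominus> b n)"
proof -
  have "a \<ominus>\<^bsub>K\<^esub> b = a \<oplus>\<^bsub>K\<^esub> (-1) \<odot>\<^bsub>K\<^esub> b"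
    using assms by (simp add: K.smult_minus_one a_minus_def)
  then show ?thesis
    using assms by (simp add: K_sel a_minus_def smult_minus_one)
qed

text \<open>A Cauchy sequence in \<open>K\<close> is Cauchy in every coordinate, uniformly in the
  index. Coordinatewise limits therefore give the limit in \<open>K\<close>, once they are shown to
  form an element of \<open>K\<close>.\<close>

lemma K_hilbert_space: "hilbert_space K"
proof (rule hilbert_space.intro[OF K_inner_product_space], unfold_locales)
  interpret KM: Metric_space "carrier K" "hdist K" by (rule K.Metric_space_hdist)
  show "KM.mcomplete"
    unfolding KM.mcomplete_def
  proof (intro allI impI)
    fix s assume "KM.MCauchy s"
    then have s: "\<And>k. s k \<in> carrier K"
      and C: "\<And>e. 0 < e \<Longrightarrow> \<exists>N. \<forall>k l. N \<le> k \<longrightarrow> N \<le> l \<longrightarrow> hnorm K (s k \<ominus>\<^bsub>K\<^esub> s l) < e"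
      by (auto simp: KM.MCauchy_def hdist_def image_subset_iff)
    have coord: "hnorm H (s k n \<ominus> s l n) \<le> hnorm K (s k \<ominus>\<^bsub>K\<^esub> s l)" for k l n
      using K_hnorm_ge[OF K.minus_closed[OF s s], of k l n] by (simp add: K_diff[OF s s])
    have "\<exists>x. x \<in> carrier H \<and> (\<lambda>k. hnorm H (s k n \<ominus> x)) \<longlonglongrightarrow> 0" for n
    proof (rule Cauchy_has_limit[of "\<lambda>k. s k n"])
      fix e :: real assume "0 < e"
      then show "\<exists>N. \<forall>m\<ge>N. \<forall>k\<ge>N. hnorm H (s m n \<ominus> s k n) < e"
        using C[of e] coord by (meson order_le_less_trans)
    qed (use s in auto)
    then obtain a where a: "\<And>n. a n \<in> carrier H"
      and lim: "\<And>n. (\<lambda>k. hnorm H (s k n \<ominus> a n)) \<longlonglongrightarrow> 0"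
      by metis
    \<comment> \<open>Letting \<open>l\<close> tend to infinity in the Cauchy estimate gives a bound
      that does not depend on the coordinate \<open>n\<close>.\<close>
    have close: "hnorm H (s k n \<ominus> a n) \<le> e"
      if "\<And>l. N \<le> l \<Longrightarrow> hnorm K (s k \<ominus>\<^bsub>K\<^esub> s l) < e" for N k n e
    proof -
      have "hnorm H (s k n \<ominus> a n) \<le> e + hnorm H (s l n \<ominus> a n)" if "N \<le> l" for l
        using hnorm_triangle_minus[of "s k n" "s l n" "a n"] coord[of k n l] s a
          \<open>\<And>l. N \<le> l \<Longrightarrow> hnorm K (s k \<ominus>\<^bsub>K\<^esub> s l) < e\<close>[OF that] by fastforce
      moreover have "(\<lambda>l. e + hnorm H (s l n \<ominus> a n)) \<longlonglongrightarrow> e"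
        using tendsto_add[OF tendsto_const lim, of e] by simp
      ultimately show ?thesis
        by (intro LIMSEQ_le_const) auto
    qed
    have aK: "a \<in> carrier K"
    proof -
      obtain N where N: "\<And>l. N \<le> l \<Longrightarrow> hnorm K (s N \<ominus>\<^bsub>K\<^esub> s l) < 1"
        using C[of 1] by auto
      have "hnorm H (a n) \<le> hnorm K (s N) + 1" for n
        using close[of N N 1 n] N K_hnorm_ge[OF s, of N n] abs_hnorm_diff_le[of "s N n" "a n"] s a
        by auto
      \<comment> \<open>Both sides are limits of \<open>s k n\<close> as \<open>k\<close> grows: the
        right one by the choice of \<open>a\<close>, the left one because the adjoint of
        \<open>X\<close> is a contraction, hence continuous.\<close>
      moreover have "adjoint X (a (Suc n)) = a n" for n
      proof -
        have c: "adjoint X (a (Suc n)) \<in> carrier H" using X a by simp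
        have "hnorm H (s k n \<ominus> adjoint X (a (Suc n))) \<le> hnorm H (s k (Suc n) \<ominus> a (Suc n))" for k
        proof -
          have "s k n \<ominus> adjoint X (a (Suc n)) = adjoint X (s k (Suc n) \<ominus> a (Suc n))"
            using X a s adjoint_add[OF X, of "s k (Suc n)" "(-1) \<odot> a (Suc n)"]
              adjoint_smult[OF X, of "a (Suc n)" "-1"]
            by (simp add: a_minus_def smult_minus_one)
          then show ?thesis
            using hnorm_adjoint_le[OF X, of "s k (Suc n) \<ominus> a (Suc n)"] a s by simp
        qed
        then have "(\<lambda>k. hnorm H (s k n \<ominus> adjoint X (a (Suc n)))) \<longlonglongrightarrow> 0"
          using s c hnorm_nonneg
            by (intro tendsto_0_le[OF lim[of "Suc n"], of _ 1] always_eventually allI)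
              (simp add: order_trans[OF _ abs_ge_self])
        from tendsto_add[OF this lim[of n]]
        have "(\<lambda>k. hnorm H (s k n \<ominus> adjoint X (a (Suc n))) + hnorm H (s k n \<ominus> a n)) \<longlonglongrightarrow> 0"
          by simp
        moreover have "hnorm H (adjoint X (a (Suc n)) \<ominus> a n) \<le>
            hnorm H (s k n \<ominus> adjoint X (a (Suc n))) + hnorm H (s k n \<ominus> a n)" for k
          using hnorm_triangle_minus[of "adjoint X (a (Suc n))" "s k n" "a n"]
            hnorm_minus_commute[of "s k n" "adjoint X (a (Suc n))"] s a c by simp
        ultimately have "hnorm H (adjoint X (a (Suc n)) \<ominus> a n) \<le> 0"
          by (intro LIMSEQ_le_const) auto
        then have "hnorm H (adjoint X (a (Suc n)) \<ominus> a n) = 0"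
          using hnorm_nonneg[of "adjoint X (a (Suc n)) \<ominus> a n"] a c by simp
        then show ?thesis
          using a c by (simp add: hnorm_eq_zero minus_eq_zero_iff)
      qed
      ultimately show ?thesis
        using a by (intro K_I) auto
    qed
    have "\<exists>N. \<forall>k\<ge>N. hnorm K (s k \<ominus>\<^bsub>K\<^esub> a) < e" if e: "0 < e" for e
    proof -
      obtain N where N: "\<And>k l. N \<le> k \<Longrightarrow> N \<le> l \<Longrightarrow> hnorm K (s k \<ominus>\<^bsub>K\<^esub> s l) < e / 2"
        using C[OF half_gt_zero[OF e]] by blast
      have "hnorm K (s k \<ominus>\<^bsub>K\<^esub> a) \<le> e / 2" if "N \<le> k" for k
      proof -
        \<comment> \<open>A bound shared by all coordinates passes to the norm of \<open>K\<close>,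
          their limit.\<close>
        have "hnorm H ((s k \<ominus>\<^bsub>K\<^esub> a) n) \<le> e / 2" for n
          using close[of N k "e/2" n] N that s aK by (auto simp: K_diff)
        then show ?thesis
          using s aK by (intro LIMSEQ_le_const2[OF K_hnorm_tendsto]) auto
      qed
      then show ?thesis
        using e by (intro exI[of _ N]) force
    qed
    then have "limitin KM.mtopology s a sequentially"
      using s aK by (auto simp: KM.limitin_metric hdist_def eventually_sequentially)
    then show "\<exists>x. limitin KM.mtopology s x sequentially" by blast
  qed
qed

sublocale K: hilbert_space K
  by (rule K_hilbert_space)

section \<open>The isometric embedding of \<open>H\<close>\<close>

definition embed :: "'a \<Rightarrow> nat \<Rightarrow> 'a"
  where "embed h = (\<lambda>n. (X ^^ n) h)"

lemma embed_apply: "embed h n = (X ^^ n) h"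
  by (simp add: embed_def)

lemma isometric_funpow: "isometric_map H H (X ^^ n)"
proof (induction n)
  case (Suc n)
  then show ?case using isometric_map_comp[OF X Suc] by (simp only: funpow.simps)
qed (simp only: funpow.simps isometric_map_id)

lemma X_funpow_closed [simp]: "h \<in> carrier H \<Longrightarrow> (X ^^ n) h \<in> carrier H"
  using isometric_map_closed[OF isometric_funpow] .

lemma hnorm_X_funpow [simp]: "h \<in> carrier H \<Longrightarrow> hnorm H ((X ^^ n) h) = hnorm H h"
  using isometric_funpow[of n] by (simp add: isometric_map_def)

text \<open>For \<open>h\<close> in \<open>H\<close> the projections of the powers of the extension
  applied to \<open>h\<close> are just the iterates of \<open>X\<close>. They are compatible because
  the adjoint of \<open>X\<close> is a left inverse of \<open>X\<close>, and bounded because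
  \<open>X\<close> is isometric.\<close>

lemma embed_closed [simp]: "h \<in> carrier H \<Longrightarrow> embed h \<in> carrier K"
  using X by (intro K_I[of _ "hnorm H h"]) (auto simp: embed_def adjoint_isometry)

lemma hnorm_embed:
  assumes h: "h \<in> carrier H"
  shows "hnorm K (embed h) = hnorm H h"
proof -
  have "(\<lambda>n. hnorm H h) \<longlonglongrightarrow> hnorm K (embed h)"
    using K_hnorm_tendsto[OF embed_closed[OF h]] h by (simp add: embed_def)
  then show ?thesis by (simp add: LIMSEQ_const_iff)
qed

lemma embed_isometric: "isometric_map H K embed"
  using isometric_funpow
  by (auto simp: isometric_map_def hnorm_embed linear_map_def K_sel) (auto simp: embed_def)

lemma embed_diff:
  assumes "g \<in> carrier H" "h \<in> carrier H"
  shows "embed g \<ominus>\<^bsub>K\<^esub> embed h = embed (g \<ominus> h)"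
proof -
  have "(X ^^ n) (g \<ominus> h) = (X ^^ n) g \<ominus> (X ^^ n) h" for n
  proof -
    have "(X ^^ n) (g \<oplus> (-1) \<odot> h) = (X ^^ n) g \<oplus> (-1) \<odot> (X ^^ n) h"
      using assms isometric_funpow[of n] by (simp add: isometric_map_def linear_map_def)
    then show ?thesis
      using assms by (simp add: a_minus_def smult_minus_one)
  qed
  then show ?thesis
    using assms by (simp add: K_diff) (simp add: embed_def)
qed

text \<open>A sequence \<open>a\<close> lies in the range of the embedding iff it is the embedding of \<open>a 0\<close>.\<close>

lemma embed_range_closed: "closedin (htopology K) (embed ` carrier H)"
proof -
  interpret KM: Metric_space "carrier K" "hdist K" by (rule K.Metric_space_hdist)
  have "\<exists>r>0. disjnt (embed ` carrier H) (KM.mball a r)"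
    if a: "a \<in> carrier K" and na: "a \<notin> embed ` carrier H" for a
  proof (intro exI conjI)
    let ?e = "embed (a 0)"
    \<comment> \<open>Half the distance from \<open>a\<close> to the embedding of
      \<open>a 0\<close>. If \<open>embed h\<close> were within \<open>r\<close> of
      \<open>a\<close>, coordinate 0 would put \<open>h\<close> within \<open>r\<close> of
      \<open>a 0\<close>; as \<open>embed\<close> is isometric, the triangle inequality would make
      the distance less than \<open>2 * r\<close>.\<close>
    define r where "r = hnorm K (a \<ominus>\<^bsub>K\<^esub> ?e) / 2"
    have "a \<noteq> ?e" using na a by auto
    then have "hnorm K (a \<ominus>\<^bsub>K\<^esub> ?e) \<noteq> 0"
      using a K.hnorm_eq_zero[of "a \<ominus>\<^bsub>K\<^esub> ?e"] K.minus_eq_zero_iff[of a ?e] by simp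
    then show "0 < r"
      using a K.hnorm_nonneg[of "a \<ominus>\<^bsub>K\<^esub> ?e"] by (simp add: r_def)
    show "disjnt (embed ` carrier H) (KM.mball a r)"
    proof (rule ccontr)
      assume "\<not> disjnt (embed ` carrier H) (KM.mball a r)"
      then obtain h where h: "h \<in> carrier H" "hnorm K (a \<ominus>\<^bsub>K\<^esub> embed h) < r"
        using a by (auto simp: disjnt_iff KM.in_mball hdist_def)
      have "(a \<ominus>\<^bsub>K\<^esub> embed h) 0 = a 0 \<ominus> h"
        using a h by (simp add: K_diff) (simp add: embed_def)
      then have "hnorm H (a 0 \<ominus> h) < r"
        using K_hnorm_ge[of "a \<ominus>\<^bsub>K\<^esub> embed h" 0] a h by simp
      moreover have "hnorm K (embed h \<ominus>\<^bsub>K\<^esub> ?e) = hnorm H (a 0 \<ominus> h)"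
        using a h by (simp add: embed_diff hnorm_embed hnorm_minus_commute)
      ultimately have "hnorm K (a \<ominus>\<^bsub>K\<^esub> ?e) < 2 * r"
        using K.hnorm_triangle_minus[of a "embed h" ?e] a h by simp
      then show False by (simp add: r_def)
    qed
  qed
  then show ?thesis
    by (auto simp: htopology_def KM.closedin_metric)
qed

lemma embed_hilbert_extension: "hilbert_extension H K embed"
  by (simp add: hilbert_extension_def K_hilbert_space embed_isometric embed_range_closed)

text \<open>The operators \<open>shift\<close> and \<open>coshift\<close> are the minimal unitary extension of \<open>X\<close> and its inverse.\<close>

definition shift :: "(nat \<Rightarrow> 'a) \<Rightarrow> nat \<Rightarrow> 'a"
  where "shift a = (\<lambda>n. a (Suc n))"

definition coshift :: "(nat \<Rightarrow> 'a) \<Rightarrow> nat \<Rightarrow> 'a"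
  where "coshift a = (\<lambda>n. adjoint X (a n))"

lemma shift_closed [simp]: "a \<in> carrier K \<Longrightarrow> shift a \<in> carrier K"
  using K_hnorm_ge by (intro K_I[of _ "hnorm K a"]) (auto simp: shift_def)

lemma hnorm_shift:
  assumes a: "a \<in> carrier K"
  shows "hnorm K (shift a) = hnorm K a"
proof -
  have "(\<lambda>n. hnorm H (a (Suc n))) \<longlonglongrightarrow> hnorm K (shift a)"
    using K_hnorm_tendsto[OF shift_closed[OF a]] by (simp add: shift_def)
  then show ?thesis
    using LIMSEQ_Suc[OF K_hnorm_tendsto[OF a]] by (rule LIMSEQ_unique)
qed

text \<open>
  If \<open>X F = c F X\<close>, the adjoint of the extension of \<open>F\<close> to \<open>K\<close> acts on coordinates, whereas the
  extension itself does not, because the projection onto \<open>H\<close> intertwines only adjoints.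
\<close>

definition adjoint_ext :: "complex \<Rightarrow> ('a \<Rightarrow> 'a) \<Rightarrow> (nat \<Rightarrow> 'a) \<Rightarrow> nat \<Rightarrow> 'a"
  where "adjoint_ext c F a = (\<lambda>n. cnj c ^ n \<odot> adjoint F (a n))"

definition scalar_commuting :: "complex \<Rightarrow> ('a \<Rightarrow> 'a) \<Rightarrow> bool"
  where "scalar_commuting c F \<longleftrightarrow> isometric_map H H F \<and> cmod c = 1 \<and>
    (\<forall>x\<in>carrier H. X (F x) = c \<odot> F (X x))"

text \<open>From \<open>X F = c F X\<close> follows
  \<open>X\<^sup>* F\<^sup>* = c F\<^sup>* X\<^sup>*\<close>. The surplus \<open>c\<close> cancels
  one factor of \<open>cnj c ^ Suc n\<close>, which is the reason for the powers in
  \<open>adjoint_ext\<close>.\<close>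

lemma adjoint_ext_closed [simp]:
  assumes F: "scalar_commuting c F" and a: "a \<in> carrier K"
  shows "adjoint_ext c F a \<in> carrier K"
proof (rule K_I)
  have iso: "isometric_map H H F" and c: "cmod c = 1" "c * cnj c = 1"
    and com: "\<And>x. x \<in> carrier H \<Longrightarrow> X (F x) = c \<odot> F (X x)"
    using F by (auto simp: scalar_commuting_def complex_norm_square[symmetric])
  show "adjoint_ext c F a n \<in> carrier H" for n
    using iso a by (simp add: adjoint_ext_def)
  show "hnorm H (adjoint_ext c F a n) \<le> hnorm K a" for n
    using iso a c hnorm_adjoint_le[OF iso, of "a n"] K_hnorm_ge[OF a, of n]
    by (simp add: adjoint_ext_def hnorm_smult norm_power)
  show "adjoint X (adjoint_ext c F a (Suc n)) = adjoint_ext c F a n" for n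
  proof -
    have cl: "a n \<in> carrier H" "a (Suc n) \<in> carrier H" using a by auto
    have "adjoint X (adjoint F (a (Suc n))) = adjoint (\<lambda>g. F (X g)) (a (Suc n))"
      using adjoint_comp'[OF iso X cl(2)] by simp
    also have "\<dots> = cnj (cnj c) \<odot> adjoint F (adjoint X (a (Suc n)))"
    proof (rule adjoint_comp[OF X iso cl(2)])
      fix g assume g: "g \<in> carrier H"
      then have "cnj c \<odot> X (F g) = (cnj c * c) \<odot> F (X g)"
        using com[OF g] smult_assoc1[of "cnj c" c "F (X g)"] X iso
        by (simp add: isometric_map_closed)
      then show "F (X g) = cnj c \<odot> X (F g)"
        using c g X iso by (simp add: mult.commute isometric_map_closed)
    qed
    finally have "adjoint X (adjoint F (a (Suc n))) = c \<odot> adjoint F (a n)"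
      using a by simp
    then have "adjoint X (adjoint_ext c F a (Suc n)) = cnj c ^ Suc n \<odot> (c \<odot> adjoint F (a n))"
      using cl iso X by (simp add: adjoint_ext_def adjoint_smult)
    also have "\<dots> = (cnj c ^ n * (c * cnj c)) \<odot> adjoint F (a n)"
      using cl iso smult_assoc1[of "cnj c ^ Suc n" c "adjoint F (a n)"] by (simp add: ac_simps)
    finally show ?thesis
      using c by (simp add: adjoint_ext_def)
  qed
qed

lemma hnorm_adjoint_ext_le:
  assumes F: "scalar_commuting c F" and a: "a \<in> carrier K"
  shows "hnorm K (adjoint_ext c F a) \<le> hnorm K a"
proof (rule LIMSEQ_le[OF K_hnorm_tendsto K_hnorm_tendsto])
  have "hnorm H (adjoint_ext c F a n) \<le> hnorm H (a n)" for n
    using F a hnorm_adjoint_le[of F "a n"]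
    by (simp add: scalar_commuting_def adjoint_ext_def hnorm_smult norm_power)
  then show "\<exists>N. \<forall>n\<ge>N. hnorm H (adjoint_ext c F a n) \<le> hnorm H (a n)" by blast
qed (use assms in auto)

lemma adjoint_ext_linear:
  assumes F: "scalar_commuting c F"
  shows "linear_map K K (adjoint_ext c F)"
proof -
  have iso: "isometric_map H H F" using F by (simp add: scalar_commuting_def)
  show ?thesis
    unfolding linear_map_def
  proof (intro conjI ballI allI)
    fix a b assume "a \<in> carrier K" "b \<in> carrier K"
    then show "adjoint_ext c F (a \<oplus>\<^bsub>K\<^esub> b) = adjoint_ext c F a \<oplus>\<^bsub>K\<^esub> adjoint_ext c F b"
      using iso smult_r_distr by (auto simp: adjoint_ext_def K_sel adjoint_add)
  next
    fix k a assume a: "a \<in> carrier K"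
    have "cnj c ^ n \<odot> adjoint F (k \<odot> a n) = k \<odot> (cnj c ^ n \<odot> adjoint F (a n))" for n
      using a iso smult_assoc1[of "cnj c ^ n" k "adjoint F (a n)"]
        smult_assoc1[of k "cnj c ^ n" "adjoint F (a n)"] by (simp add: adjoint_smult mult.commute)
    then show "adjoint_ext c F (k \<odot>\<^bsub>K\<^esub> a) = k \<odot>\<^bsub>K\<^esub> adjoint_ext c F a"
      by (simp add: adjoint_ext_def K_sel)
  qed (use F in auto)
qed

text \<open>Exhibits \<open>coshift\<close> as the instance \<open>F = X\<close>,
  \<open>c = 1\<close>, so that results on \<open>adjoint_ext\<close> apply to it.\<close>

lemma adjoint_ext_X: "a \<in> carrier K \<Longrightarrow> adjoint_ext 1 X a = coshift a"
  using X by (simp add: adjoint_ext_def coshift_def)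

lemma scalar_commuting_X: "scalar_commuting 1 X"
  using X by (simp add: scalar_commuting_def isometric_map_closed)

lemma coshift_closed [simp]: "a \<in> carrier K \<Longrightarrow> coshift a \<in> carrier K"
  using adjoint_ext_closed[OF scalar_commuting_X] by (simp add: adjoint_ext_X)

lemma shift_coshift [simp]: "a \<in> carrier K \<Longrightarrow> shift (coshift a) = a"
  and coshift_shift [simp]: "a \<in> carrier K \<Longrightarrow> coshift (shift a) = a"
  by (auto simp: shift_def coshift_def)

lemma hnorm_coshift: "a \<in> carrier K \<Longrightarrow> hnorm K (coshift a) = hnorm K a"
  using hnorm_shift[of "coshift a"] by simp

lemma shift_unitary: "unitary_op K shift"
proof (rule K.unitary_opI)
  show "isometric_map K K shift"
    by (auto simp: isometric_map_def linear_map_def hnorm_shift) (auto simp: shift_def K_sel)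
  show "bij_betw shift (carrier K) (carrier K)"
    by (rule bij_betw_byWitness[where f' = coshift]) auto
qed

lemma shift_embed: "shift (embed h) = embed (X h)"
  by (simp add: shift_def embed_def funpow_Suc_right del: funpow.simps)

text \<open>Constants multiply and operators compose in reverse order. The right-hand side is
  \<open>adjoint_ext (c * e)\<close> of the composite in unfolded form, ready for comparison
  coordinate by coordinate.\<close>

lemma adjoint_ext_comp:
  assumes F: "scalar_commuting c F" and G: "isometric_map H H G" and a: "a \<in> carrier K"
  shows "adjoint_ext e G (adjoint_ext c F a) = (\<lambda>n. cnj (c * e) ^ n \<odot> adjoint (\<lambda>x. F (G x)) (a n))"
proof
  fix n
  have iso: "isometric_map H H F" using F by (simp add: scalar_commuting_def)
  have "adjoint_ext e G (adjoint_ext c F a) n = cnj e ^ n \<odot> (cnj c ^ n \<odot> adjoint G (adjoint F (a n)))"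
    using iso G a by (simp add: adjoint_ext_def adjoint_smult)
  also have "\<dots> = cnj (c * e) ^ n \<odot> adjoint G (adjoint F (a n))"
    using iso G a smult_assoc1[of "cnj e ^ n" "cnj c ^ n" "adjoint G (adjoint F (a n))"]
    by (simp add: power_mult_distrib mult.commute)
  also have "adjoint G (adjoint F (a n)) = adjoint (\<lambda>x. F (G x)) (a n)"
    using adjoint_comp'[OF iso G] a by simp
  finally show "adjoint_ext e G (adjoint_ext c F a) n =
    cnj (c * e) ^ n \<odot> adjoint (\<lambda>x. F (G x)) (a n)" .
qed

text \<open>
  Both \<open>F\<^sup>* G\<^sup>*\<close> and \<open>G\<^sup>* F\<^sup>*\<close> act on \<open>K\<close> as a unimodular multiple of the bijective
  isometry \<open>coshift\<close>; since the factors are contractions, they are isometric and bijective too.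
\<close>

lemma adjoint_ext_unitary:
  assumes F: "scalar_commuting c F" and G: "isometric_map H H G"
    and XFG: "\<And>x. x \<in> carrier H \<Longrightarrow> X x = F (G x)"
  shows "unitary_op K (adjoint_ext c F)"
proof -
  have iso: "isometric_map H H F" and c: "cmod c = 1" "c * cnj c = 1"
    and com: "\<And>x. x \<in> carrier H \<Longrightarrow> X (F x) = c \<odot> F (X x)"
    using F by (auto simp: scalar_commuting_def complex_norm_square[symmetric])
  note cl = isometric_map_closed[OF iso] isometric_map_closed[OF G] isometric_map_closed[OF X]
  have sm: "F (k \<odot> x) = k \<odot> F x" "G (k \<odot> x) = k \<odot> G x" if "x \<in> carrier H" for k x
    using that iso G by (auto simp: isometric_map_def linear_map_def)
  have cc: "cnj c \<odot> (c \<odot> x) = x" "c \<odot> (cnj c \<odot> x) = x" if "x \<in> carrier H" for x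
    using that smult_assoc1[of "cnj c" c x] smult_assoc1[of c "cnj c" x] c
    by (simp_all add: mult.commute)
  \<comment> \<open>The isometry \<open>F\<close> can be cancelled from
    \<open>F G F = X F = c F X\<close>.\<close>
  have GF: "G (F x) = c \<odot> X x" if x: "x \<in> carrier H" for x
  proof (rule isometric_map_inj[OF iso])
    have "F (G (F x)) = c \<odot> F (F (G x))"
      using com[OF x] XFG[of "F x"] XFG[of x] x cl by simp
    then show "F (G (F x)) = F (c \<odot> X x)"
      using XFG[of x] x cl sm by simp
  qed (use x cl in auto)
  have G': "scalar_commuting (cnj c) G"
    unfolding scalar_commuting_def
  proof (intro conjI ballI)
    fix x assume x: "x \<in> carrier H"
    have "G (X x) = c \<odot> X (G x)" using GF[of "G x"] XFG[of x] x cl by simp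
    then show "X (G x) = cnj c \<odot> G (X x)" using x cl cc by simp
  qed (use G c in auto)
  let ?F = "adjoint_ext c F" and ?G = "adjoint_ext (cnj c) G"
  have GF1: "?G (?F a) = coshift a" if a: "a \<in> carrier K" for a
  proof -
    have "adjoint (\<lambda>x. F (G x)) (a n) = adjoint X (a n)" for n
      using X a XFG by (intro adjoint_eqI) (auto simp: inner_adjoint)
    then show ?thesis
      using X a c by (simp add: adjoint_ext_comp[OF F G a] coshift_def)
  qed
  have FG1: "?F (?G a) = cnj c \<odot>\<^bsub>K\<^esub> coshift a" if a: "a \<in> carrier K" for a
  proof -
    have "adjoint (\<lambda>x. G (F x)) (a n) = cnj c \<odot> adjoint X (a n)" for n
      using X a GF
      by (intro adjoint_eqI) (auto simp: inner_adjoint inner_smult_left inner_smult_right cl)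
    then show ?thesis
      using X a c by (simp add: adjoint_ext_comp[OF G' iso a] coshift_def K_sel mult.commute)
  qed
  show ?thesis
  proof (rule K.unitary_opI)
    \<comment> \<open>The norm of \<open>a\<close> equals that of
      \<open>coshift a = ?G (?F a)\<close>, which is at most that of \<open>?F a\<close>, which is
      at most that of \<open>a\<close>.\<close>
    have "hnorm K (?F a) = hnorm K a" if a: "a \<in> carrier K" for a
      using hnorm_adjoint_ext_le[OF F a] hnorm_adjoint_ext_le[OF G', of "?F a"] GF1[OF a]
        hnorm_coshift[OF a] F a by simp
    then show iF: "isometric_map K K ?F"
      using adjoint_ext_linear[OF F] by (simp add: isometric_map_def)
    have "b \<in> ?F ` carrier K" if b: "b \<in> carrier K" for b
    proof
      \<comment> \<open>Since \<open>?F\<close> after \<open>?G\<close> is \<open>cnj c\<close>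
        times \<open>coshift\<close>, undoing both the scalar and \<open>coshift\<close> on
        \<open>b\<close> gives the vector to which \<open>?G\<close> has to be applied.\<close>
      let ?b = "c \<odot>\<^bsub>K\<^esub> shift b"
      have bK: "?b \<in> carrier K" using b by simp
      have "coshift ?b = c \<odot>\<^bsub>K\<^esub> b"
        using X b by (auto simp: coshift_def K_sel adjoint_smult shift_def)
      then show "b = ?F (?G ?b)"
        using FG1[OF bK] b cc by (auto simp: K_sel)
      show "?G ?b \<in> carrier K" using G' bK by simp
    qed
    moreover have "inj_on ?F (carrier K)"
      using K.isometric_map_inj[OF iF] by (auto simp: inj_on_def)
    ultimately show "bij_betw ?F (carrier K) (carrier K)"
      using F by (auto simp: bij_betw_def)
  qed
qed

section \<open>Action on the embedded copy of \<open>H\<close>\<close>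

lemma funpow_scalar_commuting:
  assumes F: "scalar_commuting c F" and x: "x \<in> carrier H"
  shows "(X ^^ n) (F x) = c ^ n \<odot> F ((X ^^ n) x)"
proof (induction n)
  case 0
  then show ?case using F x by (simp add: scalar_commuting_def isometric_map_closed)
next
  case (Suc n)
  have iso: "isometric_map H H F"
    and com: "\<And>x. x \<in> carrier H \<Longrightarrow> X (F x) = c \<odot> F (X x)"
    using F by (auto simp: scalar_commuting_def)
  note cl = isometric_map_closed[OF iso] isometric_map_closed[OF X]
  have "X (c ^ n \<odot> F ((X ^^ n) x)) = c ^ n \<odot> X (F ((X ^^ n) x))"
    using X x cl by (simp add: isometric_map_def linear_map_def)
  also have "\<dots> = c ^ Suc n \<odot> F ((X ^^ Suc n) x)"
    using x cl smult_assoc1[of "c ^ n" c "F ((X ^^ Suc n) x)"] com[of "(X ^^ n) x"]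
    by (simp add: mult.commute)
  finally show ?case using Suc by simp
qed

text \<open>The factor \<open>c ^ n\<close> from moving \<open>F\<close> past \<open>X ^^ n\<close>
  cancels against \<open>cnj c ^ n\<close>, and the adjoint of \<open>F\<close> undoes
  \<open>F\<close>. Hence it is the inverse of \<open>adjoint_ext c F\<close> that extends
  \<open>F\<close>.\<close>

lemma adjoint_ext_embed:
  assumes F: "scalar_commuting c F" and x: "x \<in> carrier H"
  shows "adjoint_ext c F (embed (F x)) = embed x"
proof
  fix n
  have iso: "isometric_map H H F" and c: "cnj c * c = 1"
    using F by (auto simp: scalar_commuting_def complex_norm_square[symmetric] mult.commute)
  have "adjoint F (c ^ n \<odot> F ((X ^^ n) x)) = c ^ n \<odot> (X ^^ n) x"
    using iso x by (simp add: adjoint_smult adjoint_isometry isometric_map_closed)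
  then show "adjoint_ext c F (embed (F x)) n = embed x n"
    using x c smult_assoc1[of "cnj c ^ n" "c ^ n" "(X ^^ n) x"]
    by (simp add: adjoint_ext_def embed_def funpow_scalar_commuting[OF F x] power_mult_distrib[symmetric])
qed

lemma unitary_extension_inv:
  assumes F: "scalar_commuting c F" and U: "unitary_op K (adjoint_ext c F)"
  shows "unitary_extension H F K embed (inv_into (carrier K) (adjoint_ext c F))"
  unfolding unitary_extension_def
proof (intro conjI ballI)
  fix h assume h: "h \<in> carrier H"
  have "inj_on (adjoint_ext c F) (carrier K)"
    using U by (auto simp: unitary_op_def bij_betw_def)
  moreover have "F h \<in> carrier H"
    using F h by (simp add: scalar_commuting_def isometric_map_closed)
  ultimately show "inv_into (carrier K) (adjoint_ext c F) (embed h) = embed (F h)"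
    using inv_into_f_f[of "adjoint_ext c F" "carrier K" "embed (F h)"] h
    by (simp add: adjoint_ext_embed[OF F h])
qed (use U embed_hilbert_extension K.unitary_op_inv_into in auto)

section \<open>Minimality of the shift\<close>

lemma coshift_funpow:
  assumes "b \<in> carrier K"
  shows "(coshift ^^ n) b \<in> carrier K \<and> ((coshift ^^ n) b) (m + n) = b m"
proof (induction n)
  case (Suc n)
  then have c: "(coshift ^^ n) b \<in> carrier K" "(coshift ^^ n) b (m + n) = b m" by blast+
  have "coshift ((coshift ^^ n) b) (m + Suc n) = adjoint X ((coshift ^^ n) b (Suc (m + n)))"
    by (simp add: coshift_def[of "(coshift ^^ n) b"])
  also have "\<dots> = b m"
    using c K_adjoint[OF c(1), of "m + n"] by (simp only:)
  finally show ?case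
    using coshift_closed[OF c(1)] by simp
qed (use assms in auto)

lemma inner_funpow:
  assumes a: "a \<in> carrier K" and h: "h \<in> carrier H"
  shows "inner_prod H (a (m + n)) ((X ^^ m) h) = inner_prod H (a n) h"
proof (induction m)
  case (Suc m)
  have "inner_prod H (a (Suc m + n)) (X ((X ^^ m) h)) =
      inner_prod H (adjoint X (a (Suc (m + n)))) ((X ^^ m) h)"
    using a h X by (subst inner_adjoint) auto
  with Suc a show ?case by simp
qed simp

text \<open>Pythagoras: \<open>(coshift ^^ n) (embed (a n))\<close> is the orthogonal projection of
  \<open>a\<close> onto the \<open>n\<close>-th backward translate of the copy of \<open>H\<close>.
  At coordinate \<open>m + n\<close> the identity follows from \<open>inner_funpow\<close>; then
  \<open>m\<close> tends to infinity.\<close>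

lemma hnorm_approx:
  assumes a: "a \<in> carrier K"
  shows "(hnorm K (a \<ominus>\<^bsub>K\<^esub> (coshift ^^ n) (embed (a n))))\<^sup>2 = (hnorm K a)\<^sup>2 - (hnorm H (a n))\<^sup>2"
proof -
  let ?b = "(coshift ^^ n) (embed (a n))"
  have b: "?b \<in> carrier K" "?b (m + n) = (X ^^ m) (a n)" for m
    using coshift_funpow[of "embed (a n)" n] a by (auto simp: embed_apply)
  have d: "a \<ominus>\<^bsub>K\<^esub> ?b \<in> carrier K" using a b by simp
  have "(hnorm H ((a \<ominus>\<^bsub>K\<^esub> ?b) (m + n)))\<^sup>2 = (hnorm H (a (m + n)))\<^sup>2 - (hnorm H (a n))\<^sup>2" for m
    using a b by (simp add: K_diff hnorm_diff_sq inner_funpow inner_self_real)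
  moreover have "(\<lambda>m. (hnorm H ((a \<ominus>\<^bsub>K\<^esub> ?b) (m + n)))\<^sup>2) \<longlonglongrightarrow> (hnorm K (a \<ominus>\<^bsub>K\<^esub> ?b))\<^sup>2"
    by (intro tendsto_intros LIMSEQ_ignore_initial_segment K_hnorm_tendsto d)
  moreover have "(\<lambda>m. (hnorm H (a (m + n)))\<^sup>2 - (hnorm H (a n))\<^sup>2) \<longlonglongrightarrow> (hnorm K a)\<^sup>2 - (hnorm H (a n))\<^sup>2"
    by (intro tendsto_intros LIMSEQ_ignore_initial_segment K_hnorm_tendsto a)
  ultimately show ?thesis by (simp add: LIMSEQ_unique)
qed

text \<open>Backward translates of \<open>H\<close> are already dense, as the error in
  \<open>hnorm_approx\<close> tends to 0. Agreement with \<open>shift\<close> is asked only on the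
  carrier, where the product of the constructed unitaries is known.\<close>

lemma minimal_extension:
  assumes W: "\<And>a. a \<in> carrier K \<Longrightarrow> W a = shift a"
  shows "minimal_unitary_extension H X K embed W"
proof -
  interpret KM: Metric_space "carrier K" "hdist K" by (rule K.Metric_space_hdist)
  let ?S = "{op_power_int K W n (embed h) |n h. h \<in> carrier H}"
  have ue: "unitary_extension H X K embed W"
    using embed_hilbert_extension K.unitary_op_cong[OF shift_unitary W]
    by (auto simp: unitary_extension_def W shift_embed)
  have inv: "inv_into (carrier K) W a = coshift a" if "a \<in> carrier K" for a
  proof (rule inv_into_f_eq)
    show "inj_on W (carrier K)"
      using ue by (auto simp: unitary_extension_def unitary_op_def bij_betw_def)
  qed (use that W in auto)
  have pow: "(inv_into (carrier K) W ^^ n) a = (coshift ^^ n) a" if "a \<in> carrier K" for a n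
  proof (induction n)
    case (Suc n)
    then show ?case using inv coshift_funpow[OF that, of n] by simp
  qed simp
  have span: "?S \<subseteq> linear_span K ?S" by (auto simp: linear_span_def)
  have mem: "(coshift ^^ n) (embed h) \<in> linear_span K ?S" if "h \<in> carrier H" for n h
  proof -
    have "op_power_int K W (- int n) (embed h) = (inv_into (carrier K) W ^^ n) (embed h)"
      \<comment> \<open>At \<open>n = 0\<close> the exponent falls into the nonnegative branch of
        \<open>op_power_int\<close>; both powers are then the identity.\<close>
      by (cases "n = 0") (simp_all add: op_power_int_def)
    then have "op_power_int K W (- int n) (embed h) = (coshift ^^ n) (embed h)"
      by (simp only: pow[OF embed_closed[OF that]])
    moreover have "op_power_int K W (- int n) (embed h) \<in> ?S" using that by blast
    ultimately show ?thesis using span by auto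
  qed
  have "\<exists>b\<in>linear_span K ?S. b \<in> KM.mball a r" if a: "a \<in> carrier K" and r: "0 < r" for a r
  proof -
    have "(\<lambda>n. (hnorm K a)\<^sup>2 - (hnorm H (a n))\<^sup>2) \<longlonglongrightarrow> (hnorm K a)\<^sup>2 - (hnorm K a)\<^sup>2"
      by (intro tendsto_intros K_hnorm_tendsto a)
    then have "\<forall>\<^sub>F n in sequentially. (hnorm K a)\<^sup>2 - (hnorm H (a n))\<^sup>2 < r\<^sup>2"
      using r by (intro order_tendstoD) auto
    then obtain n where "(hnorm K a)\<^sup>2 - (hnorm H (a n))\<^sup>2 < r\<^sup>2"
      by (auto simp: eventually_sequentially)
    then have "hnorm K (a \<ominus>\<^bsub>K\<^esub> (coshift ^^ n) (embed (a n))) < r"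
      using r by (intro power_less_imp_less_base[of _ 2 r]) (simp_all add: hnorm_approx[OF a])
    then show ?thesis
      using mem[of "a n" n] a coshift_funpow[of "embed (a n)" n]
      by (intro bexI[of _ "(coshift ^^ n) (embed (a n))"]) (auto simp: hdist_def)
  qed
  then have "carrier K = KM.mtopology closure_of linear_span K ?S"
    by (auto simp: KM.metric_closure_of)
  then show ?thesis
    using ue by (simp add: minimal_unitary_extension_def htopology_def)
qed

section \<open>Products of operators commuting with \<open>X\<close> up to a scalar\<close>

lemma scalar_commuting_comp:
  assumes F: "scalar_commuting c F" and G: "scalar_commuting e G"
  shows "scalar_commuting (c * e) (\<lambda>x. F (G x))"
  unfolding scalar_commuting_def
proof (intro conjI ballI)
  have iso: "isometric_map H H F" "isometric_map H H G"
    using F G by (auto simp: scalar_commuting_def)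
  note cl = iso[THEN isometric_map_closed] isometric_map_closed[OF X]
  show "isometric_map H H (\<lambda>x. F (G x))"
    using isometric_map_comp[OF iso] by (simp add: comp_def)
  show "cmod (c * e) = 1" using F G by (simp add: scalar_commuting_def norm_mult)
  fix x assume x: "x \<in> carrier H"
  have "F (e \<odot> G (X x)) = e \<odot> F (G (X x))"
    using iso(1) cl x by (auto simp: isometric_map_def linear_map_def)
  then show "X (F (G x)) = (c * e) \<odot> F (G (X x))"
    using F G x cl smult_assoc1[of c e "F (G (X x))"] by (simp add: scalar_commuting_def)
qed

lemma scalar_commuting_id: "scalar_commuting 1 id"
  using isometric_map_closed[OF X] by (simp add: scalar_commuting_def isometric_map_id)

lemma adjoint_ext_id: "a \<in> carrier K \<Longrightarrow> adjoint_ext 1 id a = a"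
proof
  fix n assume a: "a \<in> carrier K"
  have "adjoint id (a n) = a n" using a by (intro adjoint_eqI) auto
  then show "adjoint_ext 1 id a n = a n" using a by (simp add: adjoint_ext_def)
qed

end

section \<open>Tuples of isometries\<close>

lemma op_product_0: "op_product 0 T = id"
  by (simp add: op_product_def)

lemma op_product_Suc: "op_product (Suc m) T = (\<lambda>x. op_product m T (T (Suc m) x))"
proof -
  \<comment> \<open>The last factor is absorbed into the starting value of the fold and then pulled
    out on the right.\<close>
  have "foldr (\<circ>) xs f = foldr (\<circ>) xs id \<circ> f" for xs and f :: "'a \<Rightarrow> 'a"
    by (induction xs) (auto simp: comp_assoc)
  from this[of "map T [1..<Suc m]" "T (Suc m)"] show ?thesis
    by (simp add: op_product_def comp_def fun_eq_iff)
qed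

text \<open>Factors at transposed positions cancel and the diagonal is 1. The induction adds the
  last row and column, which are inverse to each other. This makes the constants of the individual
  operators multiply to 1.\<close>

lemma prod_prod_antisymmetric:
  fixes q :: "nat \<Rightarrow> nat \<Rightarrow> complex"
  assumes "\<And>i. i \<in> {1..d} \<Longrightarrow> q i i = 1"
    and "\<And>i j. i \<in> {1..d} \<Longrightarrow> j \<in> {1..d} \<Longrightarrow> q i j * q j i = 1"
  shows "(\<Prod>i=1..d. \<Prod>j=1..d. q j i) = 1"
  using assms
proof (induction d)
  case (Suc d)
  have IH: "(\<Prod>i=1..d. \<Prod>j=1..d. q j i) = 1"
    using Suc.prems by (intro Suc.IH) auto
  have "(\<Prod>i=1..Suc d. \<Prod>j=1..Suc d. q j i) =
      (\<Prod>i=1..d. (\<Prod>j=1..d. q j i) * q (Suc d) i) * ((\<Prod>j=1..d. q j (Suc d)) * q (Suc d) (Suc d))"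
    by simp
  also have "\<dots> = (\<Prod>i=1..d. q (Suc d) i) * (\<Prod>j=1..d. q j (Suc d))"
    using Suc.prems(1)[of "Suc d"] IH by (simp add: prod.distrib)
  also have "\<dots> = (\<Prod>i=1..d. q (Suc d) i * q i (Suc d))"
    by (simp add: prod.distrib)
  also have "\<dots> = 1"
    using Suc.prems(2) by (intro prod.neutral) auto
  finally show ?case .
qed simp

locale q_isometries = hilbert_space +
  fixes d :: nat and q :: "nat \<Rightarrow> nat \<Rightarrow> complex" and T :: "nat \<Rightarrow> 'a \<Rightarrow> 'a"
  assumes q_norm: "\<And>i j. i \<in> {1..d} \<Longrightarrow> j \<in> {1..d} \<Longrightarrow> cmod (q i j) = 1"
    and q_diag: "\<And>i. i \<in> {1..d} \<Longrightarrow> q i i = 1"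
    and q_cnj: "\<And>i j. i \<in> {1..d} \<Longrightarrow> j \<in> {1..d} \<Longrightarrow> q i j = cnj (q j i)"
    and isometric: "\<And>i. i \<in> {1..d} \<Longrightarrow> isometric_map H H (T i)"
    and q_comm: "q_commutative d q H T"
begin

lemma T_closed: "i \<in> {1..d} \<Longrightarrow> x \<in> carrier H \<Longrightarrow> T i x \<in> carrier H"
  by (rule isometric_map_closed[OF isometric])

lemma T_commute:
  "i \<in> {1..d} \<Longrightarrow> j \<in> {1..d} \<Longrightarrow> x \<in> carrier H \<Longrightarrow> T i (T j x) = q i j \<odot> T j (T i x)"
  using q_comm unfolding q_commutative_def by blast

lemma op_product_isometric: "m \<le> d \<Longrightarrow> isometric_map H H (op_product m T)"
proof (induction m)
  case (Suc m)
  then show ?case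
    using isometric_map_comp[of H "op_product m T" "T (Suc m)"] isometric[of "Suc m"]
    by (simp add: op_product_Suc comp_def)
qed (simp add: op_product_0 isometric_map_id)

text \<open>Moving \<open>T i\<close> to the left past \<open>T m\<close>, ..., \<open>T 1\<close>
  in turn collects one factor \<open>q j i\<close> from each \<open>T j\<close>.\<close>

lemma op_product_commute:
  assumes "m \<le> d" "i \<in> {1..d}" "x \<in> carrier H"
  shows "op_product m T (T i x) = (\<Prod>j=1..m. q j i) \<odot> T i (op_product m T x)"
  using assms
proof (induction m arbitrary: x)
  case 0
  then show ?case using smult_one[of "T i x"] T_closed by (simp add: op_product_0)
next
  case (Suc m)
  let ?P = "op_product m T" and ?k = "\<Prod>j=1..m. q j i"
  have P: "isometric_map H H ?P" using op_product_isometric Suc.prems by simp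
  have S: "Suc m \<in> {1..d}" using Suc.prems by simp
  note cl = isometric_map_closed[OF P] T_closed[OF S] T_closed[OF Suc.prems(2)]
  have "T (Suc m) (T i x) = q (Suc m) i \<odot> T i (T (Suc m) x)"
    using Suc.prems by (intro T_commute[OF S])
  then have "op_product (Suc m) T (T i x) = q (Suc m) i \<odot> ?P (T i (T (Suc m) x))"
    using P cl Suc.prems by (simp add: op_product_Suc isometric_map_def linear_map_def)
  also have "?P (T i (T (Suc m) x)) = ?k \<odot> T i (?P (T (Suc m) x))"
    using Suc.IH[of "T (Suc m) x"] Suc.prems cl by simp
  also have "q (Suc m) i \<odot> \<dots> = (?k * q (Suc m) i) \<odot> T i (?P (T (Suc m) x))"
    using cl Suc.prems smult_assoc1[of "q (Suc m) i" ?k "T i (?P (T (Suc m) x))"]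
    by (simp add: mult.commute)
  finally show ?case by (simp add: op_product_Suc)
qed

text \<open>Brings \<open>T i\<close> to the front, as required for
  \<open>adjoint_ext_unitary\<close>. The factors behind \<open>T i\<close> are simply appended to
  \<open>G\<close>.\<close>

lemma op_product_factor:
  assumes "m \<le> d" "i \<in> {1..m}"
  shows "\<exists>G. isometric_map H H G \<and> (\<forall>x\<in>carrier H. op_product m T x = T i (G x))"
  using assms
proof (induction m)
  case (Suc m)
  have S: "isometric_map H H (T (Suc m))" using Suc.prems isometric by simp
  show ?case
  proof (cases "i = Suc m")
    case False
    then obtain G where G: "isometric_map H H G" "\<forall>x\<in>carrier H. op_product m T x = T i (G x)"
      using Suc by auto
    have "op_product (Suc m) T x = T i ((G \<circ> T (Suc m)) x)" if "x \<in> carrier H" for x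
      using G(2) isometric_map_closed[OF S that] by (simp add: op_product_Suc)
    then show ?thesis
      using isometric_map_comp[OF G(1) S] by blast
  next
    case True
    \<comment> \<open>Here \<open>T i\<close> is the last factor. The unimodular constant from
      moving it to the front is absorbed into \<open>G\<close>, which remains isometric.\<close>
    let ?k = "\<Prod>j=1..m. q j i" and ?P = "op_product m T"
    have k: "cmod ?k = 1"
      using q_norm Suc.prems True by (simp add: prod_norm[symmetric])
    have P: "isometric_map H H ?P" using op_product_isometric Suc.prems by simp
    note cl = isometric_map_closed[OF P]
    have "isometric_map H H (\<lambda>x. ?k \<odot> ?P x)"
      unfolding isometric_map_def linear_map_def
    proof (intro conjI ballI allI)
      fix c x assume x: "x \<in> carrier H"
      have "?P (c \<odot> x) = c \<odot> ?P x"
        using P x by (simp add: isometric_map_def linear_map_def)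
      then show "?k \<odot> ?P (c \<odot> x) = c \<odot> (?k \<odot> ?P x)"
        using x cl smult_assoc1[of c ?k "?P x"] smult_assoc1[of ?k c "?P x"]
        by (simp add: mult.commute)
    next
      fix x y assume xy: "x \<in> carrier H" "y \<in> carrier H"
      have "?P (x \<oplus> y) = ?P x \<oplus> ?P y"
        using P xy by (simp add: isometric_map_def linear_map_def)
      then show "?k \<odot> ?P (x \<oplus> y) = ?k \<odot> ?P x \<oplus> ?k \<odot> ?P y"
        using xy cl smult_r_distr[of ?k "?P x" "?P y"] by simp
    next
      fix x assume x: "x \<in> carrier H"
      have "hnorm H (?P x) = hnorm H x"
        using P x by (simp add: isometric_map_def)
      then show "hnorm H (?k \<odot> ?P x) = hnorm H x"
        using x cl k by (simp add: hnorm_smult)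
    qed (use cl in auto)
    moreover have "op_product (Suc m) T x = T i (?k \<odot> ?P x)" if x: "x \<in> carrier H" for x
    proof -
      have "op_product (Suc m) T x = ?k \<odot> T i (?P x)"
        using op_product_commute[of m i x] Suc.prems x True by (simp add: op_product_Suc)
      also have "\<dots> = T i (?k \<odot> ?P x)"
        using isometric[of i] Suc.prems cl x by (auto simp: isometric_map_def linear_map_def)
      finally show ?thesis .
    qed
    ultimately show ?thesis by blast
  qed
qed simp

section \<open>The unitary tuple on the extension space of the full product\<close>

sublocale isometry H "op_product d T"
  by unfold_locales (simp add: op_product_isometric)

text \<open>The constant \<open>c\<close> for which \<open>op_product d T\<close> commutes with
  \<open>T i\<close> up to \<open>c\<close>, by \<open>op_product_commute\<close> with
  \<open>m = d\<close>.\<close>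

definition twist :: "nat \<Rightarrow> complex"
  where "twist i = (\<Prod>j=1..d. q j i)"

definition Z :: "nat \<Rightarrow> (nat \<Rightarrow> 'a) \<Rightarrow> nat \<Rightarrow> 'a"
  where "Z i = adjoint_ext (twist i) (T i)"

definition Y :: "nat \<Rightarrow> (nat \<Rightarrow> 'a) \<Rightarrow> nat \<Rightarrow> 'a"
  where "Y i = inv_into (carrier K) (Z i)"

lemma scalar_commuting_T:
  assumes "i \<in> {1..d}"
  shows "scalar_commuting (twist i) (T i)"
  unfolding scalar_commuting_def twist_def
  using assms isometric op_product_commute[of d i] q_norm by (simp add: prod_norm[symmetric])

lemma Z_unitary:
  assumes i: "i \<in> {1..d}"
  shows "unitary_op K (Z i)"
proof -
  obtain G where "isometric_map H H G" "\<forall>x\<in>carrier H. op_product d T x = T i (G x)"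
    using op_product_factor[of d i] i by auto
  then show ?thesis
    unfolding Z_def using adjoint_ext_unitary[OF scalar_commuting_T[OF i]] by blast
qed

lemma Z_closed: "i \<in> {1..d} \<Longrightarrow> a \<in> carrier K \<Longrightarrow> Z i a \<in> carrier K"
  unfolding Z_def by (rule adjoint_ext_closed[OF scalar_commuting_T])

lemma Y_closed: "i \<in> {1..d} \<Longrightarrow> a \<in> carrier K \<Longrightarrow> Y i a \<in> carrier K"
  and Z_Y: "i \<in> {1..d} \<Longrightarrow> a \<in> carrier K \<Longrightarrow> Z i (Y i a) = a"
  and Y_Z: "i \<in> {1..d} \<Longrightarrow> a \<in> carrier K \<Longrightarrow> Y i (Z i a) = a"
  using Z_unitary[of i]
  by (auto simp: unitary_op_def bij_betw_def Y_def inv_into_into f_inv_into_f)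

lemma Y_extension: "i \<in> {1..d} \<Longrightarrow> unitary_extension H (T i) K embed (Y i)"
  unfolding Y_def Z_def
  using unitary_extension_inv[OF scalar_commuting_T] Z_unitary by (simp add: Z_def)

text \<open>Taking adjoints in \<open>T j T i = q j i T i T j\<close> reverses the products and
  conjugates \<open>q j i\<close> into \<open>q i j\<close>. The powers of the twists are the same
  on both sides.\<close>

lemma Z_commute:
  assumes i: "i \<in> {1..d}" and j: "j \<in> {1..d}" and a: "a \<in> carrier K"
  shows "Z i (Z j a) = q i j \<odot>\<^bsub>K\<^esub> Z j (Z i a)"
proof
  fix n
  have an: "a n \<in> carrier H" using a by simp
  have "T j (T i x) = q j i \<odot> T i (T j x)" if "x \<in> carrier H" for x
    using that by (rule T_commute[OF j i])
  then have "adjoint (\<lambda>x. T j (T i x)) (a n) = cnj (q j i) \<odot> adjoint (T j) (adjoint (T i) (a n))"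
    using i j an by (intro adjoint_comp) (auto simp: isometric)
  moreover have "adjoint (\<lambda>x. T i (T j x)) (a n) = adjoint (T j) (adjoint (T i) (a n))"
    using i j an by (intro adjoint_comp') (auto simp: isometric)
  moreover have "adjoint (T j) (adjoint (T i) (a n)) \<in> carrier H"
    using i j an by (simp add: isometric)
  ultimately have "cnj (twist j * twist i) ^ n \<odot> adjoint (\<lambda>x. T j (T i x)) (a n) =
      q i j \<odot> (cnj (twist i * twist j) ^ n \<odot> adjoint (\<lambda>x. T i (T j x)) (a n))"
    using q_cnj[OF i j] smult_assoc1[of "q i j" "cnj (twist i * twist j) ^ n" "adjoint (T j) (adjoint (T i) (a n))"]
      smult_assoc1[of "cnj (twist i * twist j) ^ n" "q i j" "adjoint (T j) (adjoint (T i) (a n))"]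
    by (simp add: mult.commute)
  then show "Z i (Z j a) n = (q i j \<odot>\<^bsub>K\<^esub> Z j (Z i a)) n"
    unfolding Z_def K_sel
    by (simp only: adjoint_ext_comp[OF scalar_commuting_T[OF j] isometric[OF i] a]
        adjoint_ext_comp[OF scalar_commuting_T[OF i] isometric[OF j] a])
qed

lemma Y_q_commutative: "q_commutative d q K Y"
  unfolding q_commutative_def
proof (intro ballI)
  fix i j a assume i: "i \<in> {1..d}" and j: "j \<in> {1..d}" and a: "a \<in> carrier K"
  let ?b = "Y j (Y i a)"
  have b: "?b \<in> carrier K" "Z i (Z j ?b) = a"
    using a i j by (simp_all only: Y_closed Z_Y)
  have qb: "q i j \<odot>\<^bsub>K\<^esub> ?b \<in> carrier K" using b by simp
  have lin: "Z k (e \<odot>\<^bsub>K\<^esub> x) = e \<odot>\<^bsub>K\<^esub> Z k x" if "k \<in> {1..d}" "x \<in> carrier K" for k e x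
    using Z_unitary[OF that(1)] that(2) by (simp add: unitary_op_def linear_map_def)
  \<comment> \<open>Inversion reverses products as well, so the relation is checked by applying
    \<open>Z j\<close> after \<open>Z i\<close> to the claimed value and recovering
    \<open>a\<close>.\<close>
  have "Z j (Z i (q i j \<odot>\<^bsub>K\<^esub> ?b)) = q i j \<odot>\<^bsub>K\<^esub> Z j (Z i ?b)"
    using b i j by (simp only: lin Z_closed)
  also have "\<dots> = a"
    using Z_commute[OF i j b(1)] b(2) by simp
  finally have "Y i (Y j a) = Y i (Y j (Z j (Z i (q i j \<odot>\<^bsub>K\<^esub> ?b))))" by simp
  also have "\<dots> = q i j \<odot>\<^bsub>K\<^esub> ?b"
    using qb i j by (simp only: Y_Z Z_closed)
  finally show "Y i (Y j a) = q i j \<odot>\<^bsub>K\<^esub> Y j (Y i a)" .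
qed

text \<open>The adjoint of a product undoes the operators \<open>Y i\<close> starting from the
  leftmost. The vector varies in the induction because the hypothesis is applied to
  \<open>Y (Suc m) a\<close>; closure and commutation are carried along for
  \<open>adjoint_ext_comp\<close>.\<close>

lemma op_product_Y_inverse:
  assumes "m \<le> d" "a \<in> carrier K"
  shows "scalar_commuting (\<Prod>i=1..m. twist i) (op_product m T) \<and> op_product m Y a \<in> carrier K \<and>
    adjoint_ext (\<Prod>i=1..m. twist i) (op_product m T) (op_product m Y a) = a"
  using assms
proof (induction m arbitrary: a)
  case 0
  then show ?case
    using scalar_commuting_id adjoint_ext_id[of a] by (simp add: op_product_0 id_def)
next
  case (Suc m)
  let ?p = "\<Prod>i=1..m. twist i" and ?a = "Y (Suc m) a"
  have S: "Suc m \<in> {1..d}" using Suc.prems by simp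
  have a: "?a \<in> carrier K" using Y_closed[OF S Suc.prems(2)] .
  have IH: "scalar_commuting ?p (op_product m T)" "op_product m Y ?a \<in> carrier K"
    "adjoint_ext ?p (op_product m T) (op_product m Y ?a) = ?a"
    using Suc.IH[OF _ a] Suc.prems by auto
  have "scalar_commuting (?p * twist (Suc m)) (op_product (Suc m) T)"
    using scalar_commuting_comp[OF IH(1) scalar_commuting_T[OF S]] by (simp only: op_product_Suc)
  moreover have "adjoint_ext (?p * twist (Suc m)) (op_product (Suc m) T) (op_product (Suc m) Y a) =
      Z (Suc m) (adjoint_ext ?p (op_product m T) (op_product m Y ?a))"
    unfolding Z_def
    by (simp only: adjoint_ext_comp[OF IH(1) isometric[OF S] IH(2)])
      (simp only: adjoint_ext_def op_product_Suc)
  ultimately show ?case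
    using IH(2,3) Z_Y[OF S Suc.prems(2)] by (simp add: op_product_Suc)
qed

text \<open>The twists multiply to 1, so the operator inverted by the product is
  \<open>coshift\<close> itself and not merely a twisted multiple of it.\<close>

lemma op_product_Y:
  assumes a: "a \<in> carrier K"
  shows "op_product d Y a = shift a"
proof -
  have qq: "q i j * q j i = 1" if "i \<in> {1..d}" "j \<in> {1..d}" for i j
    using q_cnj[OF that(2,1)] q_norm[OF that] complex_norm_square[of "q i j"] by simp
  have "(\<Prod>i=1..d. twist i) = 1"
    unfolding twist_def by (intro prod_prod_antisymmetric q_diag qq)
  then have "op_product d Y a \<in> carrier K" "coshift (op_product d Y a) = a"
    using op_product_Y_inverse[OF order.refl a] by (auto simp: adjoint_ext_X)
  then show ?thesis
    using shift_coshift by metis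
qed

end

theorem theorem6p1:
  fixes d :: nat
    and q :: "nat \<Rightarrow> nat \<Rightarrow> complex"
    and H :: "'a inner_module"
    and X :: "nat \<Rightarrow> 'a \<Rightarrow> 'a"
  assumes "2 \<le> d"
    and "\<And>i j. i \<in> {1..d} \<Longrightarrow> j \<in> {1..d} \<Longrightarrow> cmod (q i j) = 1"
    and "\<And>i. i \<in> {1..d} \<Longrightarrow> q i i = 1"
    and "\<And>i j. i \<in> {1..d} \<Longrightarrow> j \<in> {1..d} \<Longrightarrow> q i j = cnj (q j i)"
    and "hilbert_space H"
    and "\<And>i. i \<in> {1..d} \<Longrightarrow> isometric_map H H (X i)"
    and "q_commutative d q H X"
  shows "(\<exists>(K :: (nat \<Rightarrow> 'a) inner_module) V Y.
            q_commutative_unitary_extension d q H X K V Y) \<and>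
         (\<exists>(K :: (nat \<Rightarrow> 'a) inner_module) V Y.
            q_commutative_unitary_extension d q H X K V Y \<and>
            minimal_unitary_extension H (op_product d X) K V (op_product d Y))"
proof -
  interpret q_isometries H d q X
    by (intro q_isometries.intro q_isometries_axioms.intro assms)
  have "q_commutative_unitary_extension d q H X K embed Y"
    by (simp add: q_commutative_unitary_extension_def Y_extension Y_q_commutative)
  moreover have "minimal_unitary_extension H (op_product d X) K embed (op_product d Y)"
    by (rule minimal_extension) (rule op_product_Y)
  ultimately show ?thesis by blast
qed

end
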